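(* Let $M$ be a manifold and let $P$ be a closed submanifold of $M$. Then $$P\text{-}\mathrm{cat}\, M \;\geq\; \frac{\mathrm{long}\, M+1}{\mathrm{long}\, P+1}.$$
   Context: **$P$-category.** Let $X$ be a Hausdorff space and $P\subset X$ a closed subset. $P\text{-}\mathrm{cat}\,X$ is the minimal number $k$ of closed subsets $A_1,\dots,A_k$ of $X$ such that $X=\bigcup_{i=1}^k A_i$ and each $A_i$ is contractible within $X$ to $P$, i.e. for each $i$ there is a homotopy $F_i\colon A_i\times[0,1]\to X$ with $F_i(x,0)=x$ for $x\in A_i$, and $F_i(A_i\times\{1\})=P_i\subset X$ where $P_i$ is homeomorphic to $P$. If no such $k$ exists, $P\text{-}\mathrm{cat}\,X=\infty$. **Length.** $\mathrm{long}\,M$ denotes the length of the manifold $M$: the largest number of cycles of $M$ (of dimension less than $\dim M$) whose intersection is a cycle not homologous to zero. In cohomological form, it is the largest integer $q$ such that there exist elements $a_1,\dots,a_q$ of positive dimension in the cohomology ring $H^*(M;A)$ with $a_1\cdots a_q\ne0$, where $A=\mathbb{Z}$ or $\mathbb{R}$ when $M$ is orientable and $A=\mathbb{Z}_2$ when $M$ is non-orientable.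
   Formalization: Both long M and long P are taken over the coefficient ring that M's orientability determines (ℤ and ℝ, or ℤ₂); with P's own ring the claim fails, e.g. M = RP⁴, P = RP³. M is assumed nonempty. *)

theory Defs
  imports
    "HOL-Analysis.Analysis"
    "HOL-Homology.Homology"
    "HOL-Algebra.QuotRing"
    "HOL-Library.Z2"
begin

section \<open>Manifolds\<close>

definition topological_manifold :: "nat \<Rightarrow> 'a topology \<Rightarrow> bool" where
  "topological_manifold n M \<longleftrightarrow>
     Hausdorff_space M \<and> second_countable M \<and>
     (\<forall>x\<in>topspace M. \<exists>U V. openin M U \<and> x \<in> U \<and> openin (Euclidean_space n) V \<and>
        subtopology M U homeomorphic_space subtopology (Euclidean_space n) V)"

text \<open>No local flatness is required of a submanifold.\<close>

definition closed_submanifold :: "'a set \<Rightarrow> 'a topology \<Rightarrow> bool" where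
  "closed_submanifold P M \<longleftrightarrow>
     closedin M P \<and> (\<exists>m. topological_manifold m (subtopology M P))"

text \<open>An orientation chooses a generator of the local homology group \<open>H\<^sub>n(M, M - x)\<close> at
  every point, so that near every point the chosen generators are the images of a
  single class in \<open>H\<^sub>n(M, M - U)\<close>.\<close>

definition orientation :: "nat \<Rightarrow> 'a topology \<Rightarrow> ('a \<Rightarrow> 'a chain set) \<Rightarrow> bool" where
  "orientation n M \<mu> \<longleftrightarrow>
     (\<forall>x\<in>topspace M.
        \<mu> x \<in> carrier (relative_homology_group (int n) M (topspace M - {x})) \<and>
        generate (relative_homology_group (int n) M (topspace M - {x})) {\<mu> x}
          = carrier (relative_homology_group (int n) M (topspace M - {x}))) \<and>
     (\<forall>x\<in>topspace M. \<exists>U c. openin M U \<and> x \<in> U \<and>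
        c \<in> carrier (relative_homology_group (int n) M (topspace M - U)) \<and>
        (\<forall>y\<in>U. hom_induced (int n) M (topspace M - U) M (topspace M - {y}) id c = \<mu> y))"

definition orientable :: "nat \<Rightarrow> 'a topology \<Rightarrow> bool" where
  "orientable n M \<longleftrightarrow> (\<exists>\<mu>. orientation n M \<mu>)"


section \<open>The singular cohomology ring\<close>

text \<open>An element \<open>\<phi>\<close> of the direct sum of the cochain groups \<open>C\<^sup>p(X; A)\<close>: the component
  \<open>\<phi> p\<close> is given by its values on singular \<open>p\<close>-simplices and is \<open>0\<close> on all other
  functions. The coefficient ring \<open>A\<close> is the type \<open>'c\<close>.\<close>

type_synonym ('a, 'c) cochain = "nat \<Rightarrow> ((nat \<Rightarrow> real) \<Rightarrow> 'a) \<Rightarrow> 'c"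

definition cochains :: "'a topology \<Rightarrow> ('a, 'c::comm_ring_1) cochain set" where
  "cochains X = {\<phi>. (\<forall>p \<sigma>. \<not> singular_simplex p X \<sigma> \<longrightarrow> \<phi> p \<sigma> = 0) \<and>
                    finite {p. \<exists>\<sigma>. \<phi> p \<sigma> \<noteq> 0}}"

definition coboundary :: "'a topology \<Rightarrow> ('a, 'c::comm_ring_1) cochain \<Rightarrow> ('a, 'c) cochain" where
  "coboundary X \<phi> = (\<lambda>p \<sigma>.
     if p > 0 \<and> singular_simplex p X \<sigma>
     then \<Sum>k\<le>p. (-1) ^ k * \<phi> (p - 1) (singular_face p k \<sigma>) else 0)"

definition cocycles :: "'a topology \<Rightarrow> ('a, 'c::comm_ring_1) cochain set" where
  "cocycles X = {\<phi> \<in> cochains X. coboundary X \<phi> = (\<lambda>p \<sigma>. 0)}"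

definition coboundaries :: "'a topology \<Rightarrow> ('a, 'c::comm_ring_1) cochain set" where
  "coboundaries X = coboundary X ` cochains X"

text \<open>For a singular simplex \<open>\<sigma>\<close> on vertices \<open>e\<^sub>0, \<dots>, e\<^sub>n\<close>: its restriction to the face
  \<open>[e\<^sub>0, \<dots>, e\<^sub>p]\<close>, and its restriction to \<open>[e\<^sub>p, \<dots>, e\<^sub>n]\<close>, where \<open>n = p + q\<close>,
  as a singular \<open>q\<close>-simplex.\<close>

definition front_face :: "nat \<Rightarrow> ((nat \<Rightarrow> real) \<Rightarrow> 'a) \<Rightarrow> (nat \<Rightarrow> real) \<Rightarrow> 'a" where
  "front_face p \<sigma> = restrict \<sigma> (standard_simplex p)"

definition back_face :: "nat \<Rightarrow> nat \<Rightarrow> ((nat \<Rightarrow> real) \<Rightarrow> 'a) \<Rightarrow> (nat \<Rightarrow> real) \<Rightarrow> 'a" where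
  "back_face p q \<sigma> =
     restrict (\<sigma> \<circ> (\<lambda>x i. if i < p then 0 else x (i - p))) (standard_simplex q)"

definition cup :: "'a topology \<Rightarrow> ('a, 'c::comm_ring_1) cochain \<Rightarrow> ('a, 'c) cochain
    \<Rightarrow> ('a, 'c) cochain" where
  "cup X \<phi> \<psi> = (\<lambda>n \<sigma>.
     if singular_simplex n X \<sigma>
     then \<Sum>p\<le>n. \<phi> p (front_face p \<sigma>) * \<psi> (n - p) (back_face p (n - p) \<sigma>) else 0)"

definition unit_cochain :: "'a topology \<Rightarrow> ('a, 'c::comm_ring_1) cochain" where
  "unit_cochain X = (\<lambda>p \<sigma>. if p = 0 \<and> singular_simplex p X \<sigma> then 1 else 0)"

definition cocycle_ring :: "'a topology \<Rightarrow> ('a, 'c::comm_ring_1) cochain ring" where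
  "cocycle_ring X =
     \<lparr>carrier = cocycles X, mult = cup X, one = unit_cochain X,
      zero = (\<lambda>p \<sigma>. 0), add = (\<lambda>\<phi> \<psi> p \<sigma>. \<phi> p \<sigma> + \<psi> p \<sigma>)\<rparr>"

definition cohomology_ring :: "'a topology \<Rightarrow> ('a, 'c::comm_ring_1) cochain set ring" where
  "cohomology_ring X = cocycle_ring X Quot coboundaries X"

text \<open>The homogeneous elements of dimension \<open>p\<close>, that is, the subgroup \<open>H\<^sup>p(X; A)\<close>.\<close>

definition cohomology_classes :: "nat \<Rightarrow> 'a topology \<Rightarrow> ('a, 'c::comm_ring_1) cochain set set" where
  "cohomology_classes p X =
     {coboundaries X +>\<^bsub>cocycle_ring X\<^esub> z | z. z \<in> cocycles X \<and> (\<forall>q \<sigma>. q \<noteq> p \<longrightarrow> z q \<sigma> = 0)}"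


section \<open>Length and \<open>P\<close>-category\<close>

text \<open>The coefficient ring is an argument of \<open>long\<close>, so that the lengths of a manifold and of a
  submanifold can be compared over the same ring. The empty list gives the empty product \<open>1\<close>,
  which is nonzero on a nonempty space.\<close>

definition long :: "'c::comm_ring_1 itself \<Rightarrow> 'a topology \<Rightarrow> enat" where
  "long A X = Sup {enat (length as) | as :: ('a, 'c) cochain set list.
     (\<forall>a\<in>set as. \<exists>p>0. a \<in> cohomology_classes p X) \<and>
     foldr (mult (cohomology_ring X)) as \<one>\<^bsub>cohomology_ring X\<^esub> \<noteq> \<zero>\<^bsub>cohomology_ring X\<^esub>}"

definition contractible_within_to :: "'a topology \<Rightarrow> 'a set \<Rightarrow> 'a set \<Rightarrow> bool" where
  "contractible_within_to X A P \<longleftrightarrow>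
     (\<exists>f. homotopic_with (\<lambda>_. True) (subtopology X A) X id f \<and>
          subtopology X (f ` A) homeomorphic_space subtopology X P)"

definition P_cat :: "'a set \<Rightarrow> 'a topology \<Rightarrow> enat" where
  "P_cat P X = Inf {enat k | k. \<exists>A :: nat \<Rightarrow> 'a set.
     (\<forall>i<k. closedin X (A i) \<and> contractible_within_to X (A i) P) \<and>
     topspace X = (\<Union>i<k. A i)}"

end

theory Submission
  imports Defs
begin

text \<open>Let \<open>l\<close> be the length of \<open>P\<close> and suppose that \<open>M\<close> is covered by \<open>k\<close> closed sets \<open>A\<close>,
  each contractible within \<open>M\<close> to a copy of \<open>P\<close>. Manifolds are absolute neighbourhood extensors,
  so the contraction of \<open>A\<close> extends to an open neighbourhood \<open>U\<close> of \<open>A\<close>: the inclusion of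
  \<open>U\<close> into \<open>M\<close> is homotopic to a map that factors through \<open>P\<close>. Hence every product of
  \<open>l + 1\<close> classes of positive dimension vanishes on each \<open>U\<close>. Choose a representing cocycle of the
  \<open>i\<close>-th such product that is zero on all simplices in the \<open>i\<close>-th open set. The cup product
  of these \<open>k\<close> cocycles is zero on all simplices that lie in one of the open sets, and by
  barycentric subdivision it is then a coboundary. So every product of \<open>k (l + 1)\<close> classes of
  positive dimension of \<open>M\<close> is zero.\<close>

section \<open>The ring of cocycles\<close>

text \<open>Subdivision makes simplices small only with respect to an open cover, whereas
  \<open>P_cat\<close> speaks of closed sets; thickening these sets is what brings in the local
  structure of manifolds, once for \<open>M\<close> and once for the submanifold. The thickened
  homotopy must still end in a map through the submanifold, so its end is extended before the
  homotopy itself is. That a space made of Euclidean charts extends maps globally is Hanner's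
  local-to-global principle: two open sets are glued along a wall, and infinitely many charts are
  reduced to finite unions. Products are handled with cochains rather than classes, because the cup
  product of cochains looks only at front and back faces, so that vanishing on the simplices of an
  open set passes from one factor to the whole product. Both \<open>+ 1\<close> in the inequality
  come from counting: \<open>l + 1\<close> classes form a block that dies on one set, and if all
  products of \<open>k (l + 1)\<close> classes vanish, a nonzero product has at most
  \<open>k (l + 1) - 1\<close> factors.\<close>

definition shift_vertices :: "nat \<Rightarrow> (nat \<Rightarrow> real) \<Rightarrow> nat \<Rightarrow> real" where
  "shift_vertices p x = (\<lambda>i. if i < p then 0 else x (i - p))"

text \<open>\<open>shift_vertices p\<close> is the affine embedding of a simplex as the face spanned
  by the last vertices \<open>e_p, ..., e_(p+q)\<close>. With it, every identity between faces
  reduces to an identity between maps of standard simplices.\<close>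

lemma back_face_shift_vertices:
  "back_face p q \<sigma> = restrict (\<sigma> \<circ> shift_vertices p) (standard_simplex q)"
  by (simp add: back_face_def shift_vertices_def[abs_def])

lemma shift_vertices_in_standard_simplex:
  assumes "x \<in> standard_simplex q"
  shows "shift_vertices p x \<in> standard_simplex (p + q)"
proof -
  have "(\<Sum>i\<le>p+q. shift_vertices p x i) = (\<Sum>i\<in>(\<lambda>i. i + p) ` {..q}. shift_vertices p x i)"
  proof (rule sum.mono_neutral_right)
    show "\<forall>i\<in>{..p + q} - (\<lambda>i. i + p) ` {..q}. shift_vertices p x i = 0"
    proof
      fix i assume i: "i \<in> {..p + q} - (\<lambda>i. i + p) ` {..q}"
      have "i < p"
      proof (rule ccontr)
        assume "\<not> i < p"
        then have "i = (i - p) + p" "i - p \<le> q" using i by auto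
        then show False using i by blast
      qed
      then show "shift_vertices p x i = 0" by (simp add: shift_vertices_def)
    qed
  qed auto
  also have "\<dots> = (\<Sum>i\<le>q. x i)"
    by (subst sum.reindex) (auto simp: shift_vertices_def)
  finally show ?thesis
    using assms by (auto simp: standard_simplex_def shift_vertices_def)
qed

lemma continuous_map_shift_vertices:
  "continuous_map (subtopology (powertop_real UNIV) (standard_simplex q))
     (subtopology (powertop_real UNIV) (standard_simplex (p + q))) (shift_vertices p)"
proof -
  have "continuous_map (powertop_real UNIV) (powertop_real UNIV) (shift_vertices p)"
    unfolding continuous_map_componentwise_UNIV
    by (auto simp: shift_vertices_def intro: continuous_map_product_projection)
  then show ?thesis
    by (auto simp: continuous_map_in_subtopology shift_vertices_in_standard_simplex
        intro: continuous_map_from_subtopology)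
qed

lemma singular_simplex_front_face:
  assumes "singular_simplex n X \<sigma>" "p \<le> n"
  shows "singular_simplex p X (front_face p \<sigma>)"
  using assms standard_simplex_mono[OF assms(2)]
  by (auto simp: singular_simplex_def front_face_def intro: continuous_map_from_subtopology_mono)

lemma singular_simplex_back_face:
  assumes "singular_simplex (p + q) X \<sigma>"
  shows "singular_simplex q X (back_face p q \<sigma>)"
  using assms continuous_map_compose[OF continuous_map_shift_vertices]
  by (auto simp: singular_simplex_def back_face_shift_vertices)

lemma front_face_self: "singular_simplex n X \<sigma> \<Longrightarrow> front_face n \<sigma> = \<sigma>"
  by (simp add: front_face_def singular_simplex_def extensional_restrict)

lemma back_face_0: "singular_simplex n X \<sigma> \<Longrightarrow> back_face 0 n \<sigma> = \<sigma>"
  by (simp add: back_face_def singular_simplex_def extensional_restrict o_def)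

lemma front_face_front_face:
  "p \<le> m \<Longrightarrow> front_face p (front_face m \<sigma>) = front_face p \<sigma>"
  using standard_simplex_mono[of p m] by (auto simp: front_face_def fun_eq_iff)

text \<open>Both sides are the middle face \<open>[e_p, ..., e_(p+q)]\<close> of a simplex of
  dimension \<open>p + q + r\<close>. The middle factor of a triple cup product is evaluated on
  it.\<close>

lemma back_face_front_face:
  "back_face p q (front_face (p + q) \<sigma>) = front_face q (back_face p (q + r) \<sigma>)"
  using standard_simplex_mono[of q "q + r"]
  by (auto simp: front_face_def back_face_shift_vertices fun_eq_iff shift_vertices_in_standard_simplex)

lemma shift_vertices_shift_vertices:
  "shift_vertices p (shift_vertices q x) = shift_vertices (p + q) x"
  by (auto simp: shift_vertices_def fun_eq_iff)

lemma back_face_back_face: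
  "back_face q r (back_face p (q + r) \<sigma>) = back_face (p + q) r \<sigma>"
  by (auto simp: back_face_shift_vertices fun_eq_iff shift_vertices_in_standard_simplex
      shift_vertices_shift_vertices)

text \<open>This and the next three facts describe what deleting vertex \<open>k\<close> does to a
  front face and to the complementary back face: for \<open>k \<le> p\<close> only the front one
  loses a vertex, otherwise only the back one does. They are the combinatorial content of the
  Leibniz rule.\<close>

lemma front_face_singular_face_le:
  assumes "k \<le> p" "p \<le> n"
  shows "front_face p (singular_face (Suc n) k \<sigma>) = singular_face (Suc p) k (front_face (Suc p) \<sigma>)"
  using assms standard_simplex_mono[of p n]
  by (auto simp: front_face_def singular_face_def fun_eq_iff simplical_face_in_standard_simplex)

lemma front_face_singular_face_gt:
  assumes "p < k" "p \<le> n"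
  shows "front_face p (singular_face (Suc n) k \<sigma>) = front_face p \<sigma>"
proof -
  have "simplical_face k x = x" if "x \<in> standard_simplex p" for x
    using that assms by (auto simp: standard_simplex_def simplical_face_def fun_eq_iff)
  then show ?thesis
    using assms standard_simplex_mono[of p n]
    by (intro ext) (auto simp: front_face_def singular_face_def)
qed

lemma back_face_singular_face_le:
  assumes "k \<le> p"
  shows "back_face p q (singular_face (Suc (p + q)) k \<sigma>) = back_face (Suc p) q \<sigma>"
proof -
  have "simplical_face k (shift_vertices p x) = shift_vertices (Suc p) x" for x
    using assms by (auto simp: shift_vertices_def simplical_face_def fun_eq_iff)
  then show ?thesis
    by (intro ext) (auto simp: back_face_shift_vertices singular_face_def
        shift_vertices_in_standard_simplex)
qed

lemma back_face_singular_face_ge: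
  assumes "j \<le> Suc q"
  shows "back_face p q (singular_face (Suc (p + q)) (p + j) \<sigma>)
       = singular_face (Suc q) j (back_face p (Suc q) \<sigma>)"
proof -
  have "simplical_face (p + j) (shift_vertices p x) = shift_vertices p (simplical_face j x)" for x
    by (auto simp: shift_vertices_def simplical_face_def fun_eq_iff)
  moreover have "simplical_face j x \<in> standard_simplex (Suc q)" if "x \<in> standard_simplex q" for x
    using that assms by (simp add: simplical_face_in_standard_simplex)
  ultimately show ?thesis
    by (intro ext) (auto simp: back_face_shift_vertices singular_face_def
        shift_vertices_in_standard_simplex)
qed

lemma front_face_simplex_map:
  "p \<le> n \<Longrightarrow> front_face p (simplex_map n f \<sigma>) = simplex_map p f (front_face p \<sigma>)"
  using standard_simplex_mono[of p n]
  by (auto simp: front_face_def simplex_map_def fun_eq_iff)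

lemma back_face_simplex_map:
  "back_face p q (simplex_map (p + q) f \<sigma>) = simplex_map q f (back_face p q \<sigma>)"
  by (auto simp: back_face_shift_vertices simplex_map_def fun_eq_iff
      shift_vertices_in_standard_simplex)

section \<open>Operations on cochains, associativity of the cup product and the Leibniz rule\<close>

lemma cochains_add:
  assumes "\<phi> \<in> cochains X" "\<psi> \<in> cochains X"
  shows "(\<lambda>p \<sigma>. \<phi> p \<sigma> + \<psi> p \<sigma>) \<in> cochains X"
proof -
  have "{p. \<exists>\<sigma>. \<phi> p \<sigma> + \<psi> p \<sigma> \<noteq> 0} \<subseteq> {p. \<exists>\<sigma>. \<phi> p \<sigma> \<noteq> 0} \<union> {p. \<exists>\<sigma>. \<psi> p \<sigma> \<noteq> 0}"
    by auto
  then show ?thesis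
    using assms by (auto simp: cochains_def intro: finite_subset)
qed

lemma cochains_mult:
  assumes "\<phi> \<in> cochains X"
  shows "(\<lambda>p \<sigma>. a p * \<phi> p \<sigma>) \<in> cochains X"
proof -
  have "{p. \<exists>\<sigma>. a p * \<phi> p \<sigma> \<noteq> 0} \<subseteq> {p. \<exists>\<sigma>. \<phi> p \<sigma> \<noteq> 0}"
    by (auto dest: mult_not_zero)
  then show ?thesis
    using assms by (auto simp: cochains_def intro: finite_subset)
qed

lemma cochains_zero: "(\<lambda>p \<sigma>. 0) \<in> cochains X"
  by (simp add: cochains_def)

lemma cochains_coboundary:
  assumes "\<phi> \<in> cochains X"
  shows "coboundary X \<phi> \<in> cochains X"
proof -
  have "p \<in> Suc ` {p. \<exists>\<sigma>. \<phi> p \<sigma> \<noteq> 0}" if "coboundary X \<phi> p \<sigma> \<noteq> 0" for p \<sigma>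
  proof -
    have "p > 0" and "(\<Sum>k\<le>p. (-1) ^ k * \<phi> (p - 1) (singular_face p k \<sigma>)) \<noteq> 0"
      using that by (auto simp: coboundary_def split: if_splits)
    moreover then obtain k where "\<phi> (p - 1) (singular_face p k \<sigma>) \<noteq> 0"
      by (metis (no_types, lifting) mult_zero_right sum.neutral)
    ultimately show ?thesis
      by (metis (mono_tags, lifting) Suc_pred' image_eqI mem_Collect_eq)
  qed
  then have "{p. \<exists>\<sigma>. coboundary X \<phi> p \<sigma> \<noteq> 0} \<subseteq> Suc ` {p. \<exists>\<sigma>. \<phi> p \<sigma> \<noteq> 0}"
    by blast
  then have "finite {p. \<exists>\<sigma>. coboundary X \<phi> p \<sigma> \<noteq> 0}"
    by (rule finite_subset) (use assms in \<open>simp add: cochains_def\<close>)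
  moreover have "\<forall>p \<sigma>. \<not> singular_simplex p X \<sigma> \<longrightarrow> coboundary X \<phi> p \<sigma> = 0"
    by (simp add: coboundary_def)
  ultimately show ?thesis
    by (simp add: cochains_def)
qed

lemma cochains_cup:
  assumes "\<phi> \<in> cochains X" "\<psi> \<in> cochains X"
  shows "cup X \<phi> \<psi> \<in> cochains X"
proof -
  let ?A = "{p. \<exists>\<sigma>. \<phi> p \<sigma> \<noteq> 0}" and ?B = "{p. \<exists>\<sigma>. \<psi> p \<sigma> \<noteq> 0}"
  have "n \<in> (\<lambda>(p, q). p + q) ` (?A \<times> ?B)" if "cup X \<phi> \<psi> n \<sigma> \<noteq> 0" for n \<sigma>
  proof -
    have "(\<Sum>p\<le>n. \<phi> p (front_face p \<sigma>) * \<psi> (n - p) (back_face p (n - p) \<sigma>)) \<noteq> 0"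
      using that by (auto simp: cup_def split: if_splits)
    then obtain p where "p \<le> n" "\<phi> p (front_face p \<sigma>) * \<psi> (n - p) (back_face p (n - p) \<sigma>) \<noteq> 0"
      by (meson atMost_iff sum.neutral)
    then have "(p, n - p) \<in> ?A \<times> ?B" "n = p + (n - p)"
      by (auto dest: mult_not_zero)
    then show ?thesis
      by (metis (no_types, lifting) case_prod_conv image_eqI)
  qed
  then have "{n. \<exists>\<sigma>. cup X \<phi> \<psi> n \<sigma> \<noteq> 0} \<subseteq> (\<lambda>(p, q). p + q) ` (?A \<times> ?B)"
    by blast
  moreover have "finite ((\<lambda>(p, q). p + q) ` (?A \<times> ?B))"
    using assms by (auto simp: cochains_def)
  ultimately have "finite {n. \<exists>\<sigma>. cup X \<phi> \<psi> n \<sigma> \<noteq> 0}"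
    by (rule finite_subset)
  then show ?thesis
    by (auto simp: cochains_def cup_def)
qed

lemma coboundary_add:
  "coboundary X (\<lambda>p \<sigma>. \<phi> p \<sigma> + \<psi> p \<sigma>) = (\<lambda>p \<sigma>. coboundary X \<phi> p \<sigma> + coboundary X \<psi> p \<sigma>)"
  by (auto simp: coboundary_def fun_eq_iff sum.distrib distrib_left)

lemma coboundary_uminus:
  "coboundary X (\<lambda>p \<sigma>. - \<phi> p \<sigma>) = (\<lambda>p \<sigma>. - coboundary X \<phi> p \<sigma>)"
  by (auto simp: coboundary_def fun_eq_iff sum_negf)

lemma coboundary_zero: "coboundary X (\<lambda>p \<sigma>. 0) = (\<lambda>p \<sigma>. 0)"
  by (auto simp: coboundary_def fun_eq_iff)

lemma coboundary_alternate:
  "coboundary X (\<lambda>p \<sigma>. (-1) ^ p * \<phi> p \<sigma>) = (\<lambda>p \<sigma>. (-1) ^ (p + 1) * coboundary X \<phi> p \<sigma>)"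
proof (intro ext)
  fix p \<sigma>
  show "coboundary X (\<lambda>p \<sigma>. (-1) ^ p * \<phi> p \<sigma>) p \<sigma> = (-1) ^ (p + 1) * coboundary X \<phi> p \<sigma>"
    by (cases p) (auto simp: coboundary_def sum_distrib_left mult.left_commute intro!: sum.cong simp del: sum.atMost_Suc)
qed

text \<open>Both sides run over the triples \<open>p + q + r = n\<close>, grouped on the left by
  \<open>m = p + q\<close> and on the right by \<open>p\<close>.\<close>

lemma sum_triangle_reassoc:
  fixes a :: "nat \<Rightarrow> nat \<Rightarrow> nat \<Rightarrow> 'c::comm_monoid_add"
  shows "(\<Sum>m\<le>n. \<Sum>p\<le>m. a p (m - p) (n - m)) = (\<Sum>p\<le>n. \<Sum>q\<le>n - p. a p q (n - p - q))"
  by (subst (1 2) sum.Sigma, simp, simp, simp, simp, rule sum.reindex_bij_witness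
      [where i = "\<lambda>(p, q). (p + q, p)" and j = "\<lambda>(m, p). (p, m - p)"]) auto

lemma cup_assoc: "cup X (cup X \<phi> \<psi>) \<theta> = cup X \<phi> (cup X \<psi> \<theta>)"
proof (intro ext)
  fix n \<sigma>
  show "cup X (cup X \<phi> \<psi>) \<theta> n \<sigma> = cup X \<phi> (cup X \<psi> \<theta>) n \<sigma>"
  proof (cases "singular_simplex n X \<sigma>")
    case True
    \<comment> \<open>The common summand of both bracketings: the three cochains evaluated on the
      front, middle and back face. Associativity thus holds for cochains, not only up to
      coboundaries.\<close>
    define a where "a p q r = \<phi> p (front_face p \<sigma>) * \<psi> q (front_face q (back_face p (q + r) \<sigma>))
      * \<theta> r (back_face (p + q) r \<sigma>)" for p q r
    have "cup X (cup X \<phi> \<psi>) \<theta> n \<sigma> = (\<Sum>m\<le>n. \<Sum>p\<le>m. a p (m - p) (n - m))"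
    proof -
      have "cup X \<phi> \<psi> m (front_face m \<sigma>) * \<theta> (n - m) (back_face m (n - m) \<sigma>)
          = (\<Sum>p\<le>m. a p (m - p) (n - m))" if "m \<le> n" for m
      proof -
        have "front_face p (front_face m \<sigma>) = front_face p \<sigma>"
             "back_face p (m - p) (front_face m \<sigma>) = front_face (m - p) (back_face p (m - p + (n - m)) \<sigma>)"
          if "p \<le> m" for p
          using that back_face_front_face[of p "m - p" \<sigma> "n - m"] by (auto simp: front_face_front_face)
        then show ?thesis
          using singular_simplex_front_face[OF True that]
          by (auto simp: cup_def a_def sum_distrib_right intro!: sum.cong)
      qed
      then show ?thesis
        using True by (auto simp: cup_def[of X "cup X \<phi> \<psi>"] intro!: sum.cong)
    qed
    moreover have "cup X \<phi> (cup X \<psi> \<theta>) n \<sigma> = (\<Sum>p\<le>n. \<Sum>q\<le>n - p. a p q (n - p - q))"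
    proof -
      have "\<phi> p (front_face p \<sigma>) * cup X \<psi> \<theta> (n - p) (back_face p (n - p) \<sigma>)
          = (\<Sum>q\<le>n - p. a p q (n - p - q))" if "p \<le> n" for p
      proof -
        have "singular_simplex (n - p) X (back_face p (n - p) \<sigma>)"
          using singular_simplex_back_face[of p "n - p"] True that by simp
        moreover have "back_face q (n - p - q) (back_face p (n - p) \<sigma>) = back_face (p + q) (n - p - q) \<sigma>"
            if "q \<le> n - p" for q
        proof -
          have "q + (n - p - q) = n - p" using that by simp
          then show ?thesis using back_face_back_face[of q "n - p - q" p \<sigma>] by metis
        qed
        moreover have "q + (n - p - q) = n - p" if "q \<le> n - p" for q
          using that by simp
        ultimately show ?thesis
          by (simp only: cup_def a_def sum_distrib_left if_True)
             (rule sum.cong[OF refl], simp add: mult.assoc del: diff_diff_left)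
      qed
      then show ?thesis
        using True by (auto simp: cup_def[of X \<phi>] intro!: sum.cong)
    qed
    ultimately show ?thesis
      by (simp add: sum_triangle_reassoc)
  qed (simp add: cup_def)
qed

lemma cup_distrib_right:
  "cup X (\<lambda>p \<sigma>. \<phi> p \<sigma> + \<psi> p \<sigma>) \<theta> = (\<lambda>p \<sigma>. cup X \<phi> \<theta> p \<sigma> + cup X \<psi> \<theta> p \<sigma>)"
  by (auto simp: cup_def fun_eq_iff sum.distrib distrib_right)

lemma cup_distrib_left:
  "cup X \<theta> (\<lambda>p \<sigma>. \<phi> p \<sigma> + \<psi> p \<sigma>) = (\<lambda>p \<sigma>. cup X \<theta> \<phi> p \<sigma> + cup X \<theta> \<psi> p \<sigma>)"
  by (auto simp: cup_def fun_eq_iff sum.distrib distrib_left)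

lemma cup_zero_left: "cup X (\<lambda>p \<sigma>. 0) \<psi> = (\<lambda>p \<sigma>. 0)"
  by (auto simp: cup_def fun_eq_iff)

lemma cup_zero_right: "cup X \<phi> (\<lambda>p \<sigma>. 0) = (\<lambda>p \<sigma>. 0)"
  by (auto simp: cup_def fun_eq_iff)

lemma cup_unit_left:
  assumes "\<phi> \<in> cochains X"
  shows "cup X (unit_cochain X) \<phi> = \<phi>"
proof (intro ext)
  fix n \<sigma>
  show "cup X (unit_cochain X) \<phi> n \<sigma> = \<phi> n \<sigma>"
  proof (cases "singular_simplex n X \<sigma>")
    case True
    have "(\<Sum>p\<le>n. unit_cochain X p (front_face p \<sigma>) * \<phi> (n - p) (back_face p (n - p) \<sigma>))
        = (\<Sum>p\<le>n. if p = 0 then \<phi> n \<sigma> else 0)"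
      using True singular_simplex_front_face[OF True, of 0]
      by (intro sum.cong[OF refl]) (auto simp: unit_cochain_def back_face_0)
    then show ?thesis
      using True by (simp add: cup_def)
  qed (use assms in \<open>auto simp: cup_def cochains_def\<close>)
qed

lemma cup_unit_right:
  assumes "\<phi> \<in> cochains X"
  shows "cup X \<phi> (unit_cochain X) = \<phi>"
proof (intro ext)
  fix n \<sigma>
  show "cup X \<phi> (unit_cochain X) n \<sigma> = \<phi> n \<sigma>"
  proof (cases "singular_simplex n X \<sigma>")
    case True
    have "(\<Sum>p\<le>n. \<phi> p (front_face p \<sigma>) * unit_cochain X (n - p) (back_face p (n - p) \<sigma>))
        = (\<Sum>p\<le>n. if p = n then \<phi> n \<sigma> else 0)"
      using True singular_simplex_back_face[of n 0 X \<sigma>]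
      by (intro sum.cong[OF refl]) (auto simp: unit_cochain_def front_face_self)
    then show ?thesis
      using True by (simp add: cup_def)
  qed (use assms in \<open>auto simp: cup_def cochains_def\<close>)
qed

text \<open>The Leibniz rule. Cochains here mix degrees, so the usual sign \<open>(-1) ^ p\<close>
  cannot stand in front of the second term; it is applied to each component of the first factor
  instead.\<close>

lemma coboundary_cup:
  "coboundary X (cup X \<phi> \<psi>) =
     (\<lambda>n \<sigma>. cup X (coboundary X \<phi>) \<psi> n \<sigma> + cup X (\<lambda>p \<sigma>. (-1) ^ p * \<phi> p \<sigma>) (coboundary X \<psi>) n \<sigma>)"
proof (intro ext)
  fix n' \<sigma>
  show "coboundary X (cup X \<phi> \<psi>) n' \<sigma> =
    cup X (coboundary X \<phi>) \<psi> n' \<sigma> + cup X (\<lambda>p \<sigma>. (-1) ^ p * \<phi> p \<sigma>) (coboundary X \<psi>) n' \<sigma>"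
  proof (cases "n' > 0 \<and> singular_simplex n' X \<sigma>")
    case False
    then show ?thesis by (auto simp: coboundary_def cup_def)
  next
    case True
    then obtain n where n': "n' = Suc n" using gr0_conv_Suc by auto
    have ss: "singular_simplex (Suc n) X \<sigma>" using True n' by simp
    define F where "F p k = \<phi> p (singular_face (Suc p) k (front_face (Suc p) \<sigma>))
      * \<psi> (n - p) (back_face (Suc p) (n - p) \<sigma>)" for p k
    define G where "G p j = \<phi> p (front_face p \<sigma>)
      * \<psi> (n - p) (singular_face (Suc (n - p)) j (back_face p (Suc (n - p)) \<sigma>))" for p j
    have "coboundary X (cup X \<phi> \<psi>) n' \<sigma> = (\<Sum>k\<le>Suc n. (-1) ^ k * (\<Sum>p\<le>n.
        \<phi> p (front_face p (singular_face (Suc n) k \<sigma>)) * \<psi> (n - p) (back_face p (n - p) (singular_face (Suc n) k \<sigma>))))"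
      using ss singular_simplex_singular_face[OF ss]
      by (auto simp: n' coboundary_def cup_def intro!: sum.cong)
    also have "\<dots> = (\<Sum>p\<le>n. \<Sum>k\<le>Suc n. (-1) ^ k * (
        \<phi> p (front_face p (singular_face (Suc n) k \<sigma>)) * \<psi> (n - p) (back_face p (n - p) (singular_face (Suc n) k \<sigma>))))"
      unfolding sum_distrib_left by (rule sum.swap)
    also have "\<dots> = (\<Sum>p\<le>n. (\<Sum>k\<le>Suc p. (-1) ^ k * F p k) + (-1) ^ p * (\<Sum>j\<le>Suc (n - p). (-1) ^ j * G p j))"
    proof (rule sum.cong[OF refl])
      fix p assume "p \<in> {..n}"
      then have p: "p \<le> n" by simp
      have le: "\<phi> p (front_face p (singular_face (Suc n) k \<sigma>)) * \<psi> (n - p) (back_face p (n - p) (singular_face (Suc n) k \<sigma>)) = F p k"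
        if "k \<le> p" for k
        using that p front_face_singular_face_le[of k p n \<sigma>] back_face_singular_face_le[of k p "n - p" \<sigma>]
        by (simp add: F_def)
      have gt: "\<phi> p (front_face p (singular_face (Suc n) k \<sigma>)) * \<psi> (n - p) (back_face p (n - p) (singular_face (Suc n) k \<sigma>)) = G p (k - p)"
        if "p < k" "k \<le> Suc n" for k
        using that p front_face_singular_face_gt[of p k n \<sigma>] back_face_singular_face_ge[of "k - p" "n - p" p \<sigma>]
        by (simp add: G_def Suc_diff_le)
      have "{..Suc n} = {..p} \<union> {p<..Suc n}" using p by auto
      then have split: "sum f {..Suc n} = sum f {..p} + sum f {p<..Suc n}" for f :: "nat \<Rightarrow> 'b"
        by (simp only:) (rule sum.union_disjoint, auto)
      have "(\<Sum>k\<le>Suc n. (-1) ^ k * (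
        \<phi> p (front_face p (singular_face (Suc n) k \<sigma>)) * \<psi> (n - p) (back_face p (n - p) (singular_face (Suc n) k \<sigma>))))
        = (\<Sum>k\<le>p. (-1) ^ k * F p k) + (\<Sum>k\<in>{p<..Suc n}. (-1) ^ k * G p (k - p))"
        unfolding split by (intro arg_cong2[where f = "(+)"] sum.cong[OF refl]) (auto simp: le gt)
      also have "(\<Sum>k\<in>{p<..Suc n}. (-1) ^ k * G p (k - p)) = (\<Sum>j\<in>{0<..Suc (n - p)}. (-1) ^ (p + j) * G p j)"
        using p by (intro sum.reindex_bij_witness[where i = "\<lambda>j. p + j" and j = "\<lambda>k. k - p"]) auto
      also have "\<dots> = (-1) ^ p * (\<Sum>j\<in>{0<..Suc (n - p)}. (-1) ^ j * G p j)"
        by (simp add: sum_distrib_left power_add mult.assoc)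
      also have "(\<Sum>j\<in>{0<..Suc (n - p)}. (-1) ^ j * G p j) = (\<Sum>j\<le>Suc (n - p). (-1) ^ j * G p j) - G p 0"
      proof -
        have "{..Suc (n - p)} = insert 0 {0<..Suc (n - p)}" by auto
        then show ?thesis by simp
      qed
      \<comment> \<open>Completes both sums to full coboundaries. The term \<open>k = Suc p\<close>
        missing from the first and the term \<open>j = 0\<close> missing from the second are the
        same product of a front and a back face, and they enter with opposite signs.\<close>
      also have "(\<Sum>k\<le>p. (-1) ^ k * F p k) + (-1) ^ p * ((\<Sum>j\<le>Suc (n - p). (-1) ^ j * G p j) - G p 0)
        = (\<Sum>k\<le>Suc p. (-1) ^ k * F p k) + (-1) ^ p * (\<Sum>j\<le>Suc (n - p). (-1) ^ j * G p j)"
      proof -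
        have "singular_face (Suc p) (Suc p) (front_face (Suc p) \<sigma>) = front_face p \<sigma>"
        proof -
          have "singular_face (Suc p) (Suc p) (front_face (Suc p) \<sigma>) = singular_face (Suc p) (Suc p) \<sigma>"
            by (simp add: front_face_def)
          also have "\<dots> = front_face p (singular_face (Suc p) (Suc p) \<sigma>)"
            by (simp add: front_face_def singular_face_def)
          finally show ?thesis
            using front_face_singular_face_gt[of p "Suc p" p \<sigma>] by simp
        qed
        moreover have "singular_face (Suc (n - p)) 0 (back_face p (Suc (n - p)) \<sigma>) = back_face (Suc p) (n - p) \<sigma>"
          using back_face_singular_face_ge[of 0 "n - p" p \<sigma>] back_face_singular_face_le[of p p "n - p" \<sigma>] by simp
        ultimately have "F p (Suc p) = G p 0" by (simp add: F_def G_def)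
        then show ?thesis by (simp add: algebra_simps)
      qed
      finally show "(\<Sum>k\<le>Suc n. (-1) ^ k * (
        \<phi> p (front_face p (singular_face (Suc n) k \<sigma>)) * \<psi> (n - p) (back_face p (n - p) (singular_face (Suc n) k \<sigma>))))
        = (\<Sum>k\<le>Suc p. (-1) ^ k * F p k) + (-1) ^ p * (\<Sum>j\<le>Suc (n - p). (-1) ^ j * G p j)" .
    qed
    also have "\<dots> = (\<Sum>p\<le>n. \<Sum>k\<le>Suc p. (-1) ^ k * F p k) + (\<Sum>p\<le>n. (-1) ^ p * (\<Sum>j\<le>Suc (n - p). (-1) ^ j * G p j))"
      by (rule sum.distrib)
    also have "(\<Sum>p\<le>n. \<Sum>k\<le>Suc p. (-1) ^ k * F p k) = cup X (coboundary X \<phi>) \<psi> n' \<sigma>"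
    proof -
      have "cup X (coboundary X \<phi>) \<psi> n' \<sigma> = (\<Sum>m\<le>Suc n. coboundary X \<phi> m (front_face m \<sigma>) * \<psi> (Suc n - m) (back_face m (Suc n - m) \<sigma>))"
        using ss by (simp add: cup_def n' del: sum.atMost_Suc)
      also have "\<dots> = (\<Sum>p\<le>n. coboundary X \<phi> (Suc p) (front_face (Suc p) \<sigma>) * \<psi> (n - p) (back_face (Suc p) (n - p) \<sigma>))"
        by (subst sum.atMost_Suc_shift) (simp add: coboundary_def)
      also have "\<dots> = (\<Sum>p\<le>n. \<Sum>k\<le>Suc p. (-1) ^ k * F p k)"
        using singular_simplex_front_face[OF ss]
        by (intro sum.cong[OF refl]) (simp add: coboundary_def F_def sum_distrib_right mult.assoc distrib_right del: sum.atMost_Suc)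
      finally show ?thesis by simp
    qed
    also have "(\<Sum>p\<le>n. (-1) ^ p * (\<Sum>j\<le>Suc (n - p). (-1) ^ j * G p j))
      = cup X (\<lambda>p \<sigma>. (-1) ^ p * \<phi> p \<sigma>) (coboundary X \<psi>) n' \<sigma>"
    proof -
      have "cup X (\<lambda>p \<sigma>. (-1) ^ p * \<phi> p \<sigma>) (coboundary X \<psi>) n' \<sigma>
        = (\<Sum>p\<le>Suc n. (-1) ^ p * \<phi> p (front_face p \<sigma>) * coboundary X \<psi> (Suc n - p) (back_face p (Suc n - p) \<sigma>))"
        using ss by (simp add: cup_def n' del: sum.atMost_Suc)
      also have "\<dots> = (\<Sum>p\<le>n. (-1) ^ p * \<phi> p (front_face p \<sigma>) * coboundary X \<psi> (Suc (n - p)) (back_face p (Suc (n - p)) \<sigma>))"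
      proof -
        \<comment> \<open>A coboundary is \<open>0\<close> in degree \<open>0\<close> by definition,
          which removes the term \<open>p = Suc n\<close> and leaves the range
          \<open>p \<le> n\<close>.\<close>
        have "coboundary X \<psi> (Suc n - Suc n) (back_face (Suc n) (Suc n - Suc n) \<sigma>) = 0"
          by (simp add: coboundary_def)
        then show ?thesis
          by (subst sum.atMost_Suc, simp only: mult_zero_right add_0_right)
             (rule sum.cong, simp_all add: Suc_diff_le del: sum.atMost_Suc)
      qed
      also have "\<dots> = (\<Sum>p\<le>n. (-1) ^ p * (\<Sum>j\<le>Suc (n - p). (-1) ^ j * G p j))"
      proof (rule sum.cong[OF refl])
        fix p assume "p \<in> {..n}"
        then have "singular_simplex (Suc (n - p)) X (back_face p (Suc (n - p)) \<sigma>)"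
          using singular_simplex_back_face[of p "Suc (n - p)" X \<sigma>] ss by simp
        then show "(-1) ^ p * \<phi> p (front_face p \<sigma>) * coboundary X \<psi> (Suc (n - p)) (back_face p (Suc (n - p)) \<sigma>)
          = (-1) ^ p * (\<Sum>j\<le>Suc (n - p). (-1) ^ j * G p j)"
          by (simp add: coboundary_def G_def sum_distrib_left mult.assoc mult.left_commute del: sum.atMost_Suc)
      qed
      finally show ?thesis by simp
    qed
    finally show ?thesis .
  qed
qed


text \<open>The Kronecker pairing with integral chains, whose coefficients enter the ring through
  \<open>of_int\<close>. Through it, facts about \<open>chain_boundary\<close>, prisms and
  subdivision are dualised to cochains.\<close>

definition cochain_eval :: "(((nat \<Rightarrow> real) \<Rightarrow> 'a) \<Rightarrow> 'c::comm_ring_1) \<Rightarrow> 'a chain \<Rightarrow> 'c" where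
  "cochain_eval f c = (\<Sum>\<sigma>\<in>Poly_Mapping.keys c. of_int (Poly_Mapping.lookup c \<sigma>) * f \<sigma>)"

lemma cochain_eval_superset:
  assumes "finite A" "Poly_Mapping.keys c \<subseteq> A"
  shows "cochain_eval f c = (\<Sum>\<sigma>\<in>A. of_int (Poly_Mapping.lookup c \<sigma>) * f \<sigma>)"
  unfolding cochain_eval_def
  by (rule sum.mono_neutral_left) (use assms in \<open>auto simp: in_keys_iff\<close>)

lemma cochain_eval_0 [simp]: "cochain_eval f 0 = 0"
  by (simp add: cochain_eval_def)

lemma cochain_eval_of [simp]: "cochain_eval f (frag_of \<sigma>) = f \<sigma>"
  by (simp add: cochain_eval_def)

lemma cochain_eval_add: "cochain_eval f (a + b) = cochain_eval f a + cochain_eval f b"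
proof -
  let ?A = "Poly_Mapping.keys a \<union> Poly_Mapping.keys b"
  have "cochain_eval f c = (\<Sum>\<sigma>\<in>?A. of_int (Poly_Mapping.lookup c \<sigma>) * f \<sigma>)"
    if "c \<in> {a, b, a + b}" for c
    by (rule cochain_eval_superset) (use that keys_add[of a b] in auto)
  then show ?thesis
    by (simp add: lookup_add distrib_right sum.distrib)
qed

lemma cochain_eval_cmul: "cochain_eval f (frag_cmul k a) = of_int k * cochain_eval f a"
proof -
  have "cochain_eval f (frag_cmul k a)
      = (\<Sum>\<sigma>\<in>Poly_Mapping.keys a. of_int (Poly_Mapping.lookup (frag_cmul k a) \<sigma>) * f \<sigma>)"
    by (rule cochain_eval_superset) (use keys_cmul[of k a] in auto)
  then show ?thesis
    by (simp add: cochain_eval_def sum_distrib_left mult.assoc)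
qed

lemma cochain_eval_uminus: "cochain_eval f (- a) = - cochain_eval f a"
  using cochain_eval_cmul[of f "-1" a] by simp

lemma cochain_eval_diff: "cochain_eval f (a - b) = cochain_eval f a - cochain_eval f b"
  using cochain_eval_add[of f a "- b"] by (simp add: cochain_eval_uminus)

lemma cochain_eval_sum: "cochain_eval f (sum g I) = (\<Sum>i\<in>I. cochain_eval f (g i))"
  by (induction I rule: infinite_finite_induct) (simp_all add: cochain_eval_add)

lemma cochain_eval_zero:
  "(\<And>\<sigma>. \<sigma> \<in> Poly_Mapping.keys c \<Longrightarrow> f \<sigma> = 0) \<Longrightarrow> cochain_eval f c = 0"
  by (simp add: cochain_eval_def)

lemma coboundary_eq_cochain_eval:
  assumes "singular_simplex (Suc p) X \<sigma>"
  shows "coboundary X \<phi> (Suc p) \<sigma> = cochain_eval (\<phi> p) (chain_boundary (Suc p) (frag_of \<sigma>))"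
  using assms
  by (simp add: coboundary_def chain_boundary_of cochain_eval_sum cochain_eval_cmul cochain_eval_add
      cong: sum.cong)

lemma cochain_eval_coboundary:
  assumes "singular_chain (Suc p) X c"
  shows "cochain_eval (coboundary X \<phi> (Suc p)) c = cochain_eval (\<phi> p) (chain_boundary (Suc p) c)"
  using assms unfolding singular_chain_def
proof (induction c rule: frag_induction)
  case (one \<sigma>)
  then show ?case by (simp add: coboundary_eq_cochain_eval)
qed (auto simp: cochain_eval_diff chain_boundary_diff)

lemma coboundary_coboundary: "coboundary X (coboundary X \<phi>) = (\<lambda>p \<sigma>. 0)"
proof (intro ext)
  fix p \<sigma>
  show "coboundary X (coboundary X \<phi>) p \<sigma> = 0"
  proof (cases "p > 0 \<and> singular_simplex p X \<sigma>")
    case True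
    then obtain m where p: "p = Suc m" using gr0_conv_Suc by auto
    have c: "singular_chain (Suc m) X (frag_of \<sigma>)"
      using True p by (simp add: singular_chain_of)
    show ?thesis
    proof (cases m)
      case 0
      \<comment> \<open>In the lowest degree there is no double boundary to appeal to; a coboundary
        simply has no component of degree \<open>0\<close>.\<close>
      have "cochain_eval (coboundary X \<phi> 0) c = 0" for c
        by (rule cochain_eval_zero) (simp add: coboundary_def)
      then show ?thesis
        using True by (simp add: p coboundary_eq_cochain_eval 0)
    next
      case (Suc k)
      have "coboundary X (coboundary X \<phi>) p \<sigma>
          = cochain_eval (\<phi> k) (chain_boundary (Suc k) (chain_boundary (Suc m) (frag_of \<sigma>)))"
        using True singular_chain_boundary_alt[OF c]
        by (simp add: p coboundary_eq_cochain_eval Suc cochain_eval_coboundary)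
      then show ?thesis
        using chain_boundary_boundary_alt[of "Suc k" X "frag_of \<sigma>"] c by (simp add: Suc)
    qed
  qed (auto simp: coboundary_def)
qed

section \<open>Cocycles form a ring in which the coboundaries are an ideal\<close>

lemma cocycles_cochains: "\<phi> \<in> cocycles X \<Longrightarrow> \<phi> \<in> cochains X"
  by (simp add: cocycles_def)

lemma coboundaries_subset_cocycles: "coboundaries X \<subseteq> cocycles X"
  by (auto simp: coboundaries_def cocycles_def cochains_coboundary coboundary_coboundary)

lemma cocycles_add:
  "\<phi> \<in> cocycles X \<Longrightarrow> \<psi> \<in> cocycles X \<Longrightarrow> (\<lambda>p \<sigma>. \<phi> p \<sigma> + \<psi> p \<sigma>) \<in> cocycles X"
  by (simp add: cocycles_def cochains_add coboundary_add)

lemma cocycles_zero: "(\<lambda>p \<sigma>. 0) \<in> cocycles X"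
  by (simp add: cocycles_def cochains_zero coboundary_zero)

lemma cochains_uminus: "\<phi> \<in> cochains X \<Longrightarrow> (\<lambda>p \<sigma>. - \<phi> p \<sigma>) \<in> cochains X"
  using cochains_mult[of \<phi> X "\<lambda>_. -1"] by simp

lemma cocycles_uminus: "\<phi> \<in> cocycles X \<Longrightarrow> (\<lambda>p \<sigma>. - \<phi> p \<sigma>) \<in> cocycles X"
  by (simp add: cocycles_def cochains_uminus coboundary_uminus)

lemma cocycles_alternate: "\<phi> \<in> cocycles X \<Longrightarrow> (\<lambda>p \<sigma>. (-1) ^ p * \<phi> p \<sigma>) \<in> cocycles X"
  by (simp add: cocycles_def cochains_mult coboundary_alternate)

lemma cocycles_cup:
  assumes "\<phi> \<in> cocycles X" "\<psi> \<in> cocycles X"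
  shows "cup X \<phi> \<psi> \<in> cocycles X"
  using assms by (simp add: cocycles_def cochains_cup coboundary_cup cup_zero_left cup_zero_right)

lemma cocycles_unit: "(unit_cochain X :: ('a, 'b::comm_ring_1) cochain) \<in> cocycles X"
proof -
  have "finite {p. \<exists>\<sigma>. unit_cochain X p \<sigma> \<noteq> (0::'b)}"
    by (rule finite_subset[of _ "{0}"]) (auto simp: unit_cochain_def)
  moreover have "coboundary X (unit_cochain X) p \<sigma> = (0::'b)" for p \<sigma>
  proof (cases "p = 1 \<and> singular_simplex p X \<sigma>")
    case True
    then have "singular_simplex 0 X (singular_face 1 k \<sigma>)" if "k \<le> 1" for k
      using singular_simplex_singular_face[of 1 X \<sigma> k] that by auto
    then show ?thesis
      using True by (simp add: coboundary_def unit_cochain_def)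
  next
    case False
    then show ?thesis
      by (cases "p \<le> 1") (auto simp: coboundary_def unit_cochain_def le_Suc_eq)
  qed
  ultimately show ?thesis
    by (auto simp: cocycles_def cochains_def unit_cochain_def)
qed

lemma ring_cocycle_ring: "ring (cocycle_ring X :: ('a, 'c::comm_ring_1) cochain ring)"
proof (rule ringI)
  show "abelian_group (cocycle_ring X :: ('a, 'c) cochain ring)"
  proof (rule abelian_groupI)
    fix \<phi> :: "('a, 'c) cochain"
    assume "\<phi> \<in> carrier (cocycle_ring X)"
    then show "\<exists>\<psi>\<in>carrier (cocycle_ring X). \<psi> \<oplus>\<^bsub>cocycle_ring X\<^esub> \<phi> = \<zero>\<^bsub>cocycle_ring X\<^esub>"
      by (intro bexI[of _ "\<lambda>p \<sigma>. - \<phi> p \<sigma>"]) (auto simp: cocycle_ring_def cocycles_uminus)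
  qed (auto simp: cocycle_ring_def cocycles_add cocycles_zero add_ac)
  show "Group.monoid (cocycle_ring X :: ('a, 'c) cochain ring)"
    by (rule monoidI)
       (auto simp: cocycle_ring_def cocycles_cup cocycles_unit cup_assoc cup_unit_left cup_unit_right
         cocycles_cochains)
qed (auto simp: cocycle_ring_def cup_distrib_left cup_distrib_right)

lemma coboundaries_add:
  "\<phi> \<in> coboundaries X \<Longrightarrow> \<psi> \<in> coboundaries X \<Longrightarrow> (\<lambda>p \<sigma>. \<phi> p \<sigma> + \<psi> p \<sigma>) \<in> coboundaries X"
  by (auto simp: coboundaries_def coboundary_add[symmetric] cochains_add)

lemma coboundaries_uminus:
  "\<phi> \<in> coboundaries X \<Longrightarrow> (\<lambda>p \<sigma>. - \<phi> p \<sigma>) \<in> coboundaries X"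
  by (auto simp: coboundaries_def coboundary_uminus[symmetric] cochains_uminus)

lemma coboundaries_zero: "(\<lambda>p \<sigma>. 0) \<in> coboundaries X"
  unfolding coboundaries_def
  by (rule image_eqI[of _ _ "\<lambda>p \<sigma>. 0"]) (simp_all add: coboundary_zero cochains_zero)

lemma coboundaries_cup_right:
  assumes "\<phi> \<in> coboundaries X" "\<psi> \<in> cocycles X"
  shows "cup X \<phi> \<psi> \<in> coboundaries X"
proof -
  obtain \<alpha> where \<alpha>: "\<alpha> \<in> cochains X" "\<phi> = coboundary X \<alpha>"
    using assms by (auto simp: coboundaries_def)
  have "cup X \<phi> \<psi> = coboundary X (cup X \<alpha> \<psi>)"
    using assms(2) by (simp add: \<alpha>(2) coboundary_cup cocycles_def cup_zero_right)
  then show ?thesis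
    using \<alpha>(1) assms(2) by (auto simp: coboundaries_def cochains_cup cocycles_cochains)
qed

lemma coboundaries_cup_left:
  assumes "\<phi> \<in> coboundaries X" "\<psi> \<in> cocycles X"
  shows "cup X \<psi> \<phi> \<in> coboundaries X"
proof -
  obtain \<alpha> where \<alpha>: "\<alpha> \<in> cochains X" "\<phi> = coboundary X \<alpha>"
    using assms by (auto simp: coboundaries_def)
  \<comment> \<open>The twist undoes the signs that the Leibniz rule puts on the first factor, since
    twisting twice is the identity.\<close>
  define \<psi>' where "\<psi>' = (\<lambda>p \<sigma>. (-1) ^ p * \<psi> p \<sigma>)"
  have \<psi>': "\<psi>' \<in> cocycles X"
    unfolding \<psi>'_def using assms(2) by (rule cocycles_alternate)
  have "(\<lambda>p \<sigma>. (-1) ^ p * \<psi>' p \<sigma>) = \<psi>"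
    unfolding \<psi>'_def mult.assoc[symmetric] power_add[symmetric] by simp
  then have "cup X \<psi> \<phi> = coboundary X (cup X \<psi>' \<alpha>)"
    using \<psi>' by (simp add: \<alpha>(2) coboundary_cup cocycles_def cup_zero_left)
  then show ?thesis
    using \<alpha>(1) \<psi>' by (auto simp: coboundaries_def cochains_cup cocycles_cochains)
qed

text \<open>Absorption on both sides is the Leibniz rule with one factor closed. It makes
  \<open>cohomology_ring\<close> a genuine quotient, so that coset multiplication can be computed on
  representatives.\<close>

lemma ideal_coboundaries:
  "ideal (coboundaries X) (cocycle_ring X :: ('a, 'c::comm_ring_1) cochain ring)"
proof (rule idealI[OF ring_cocycle_ring])
  interpret ring "cocycle_ring X :: ('a, 'c) cochain ring" by (rule ring_cocycle_ring)
  show "subgroup (coboundaries X) (add_monoid (cocycle_ring X :: ('a, 'c) cochain ring))"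
  proof (rule group.subgroupI)
    show "Group.group (add_monoid (cocycle_ring X :: ('a, 'c) cochain ring))" by (rule a_group)
    show "coboundaries X \<subseteq> carrier (add_monoid (cocycle_ring X :: ('a, 'c) cochain ring))"
      using coboundaries_subset_cocycles by (simp add: cocycle_ring_def)
    show "(coboundaries X :: ('a, 'c) cochain set) \<noteq> {}"
      using coboundaries_zero by blast
  next
    fix \<phi> :: "('a, 'c) cochain" assume \<phi>: "\<phi> \<in> coboundaries X"
    have "\<ominus>\<^bsub>cocycle_ring X\<^esub> \<phi> = (\<lambda>p \<sigma>. - \<phi> p \<sigma>)"
      using \<phi> coboundaries_subset_cocycles[of X]
      by (intro minus_equality) (auto simp: cocycle_ring_def cocycles_uminus)
    then show "inv\<^bsub>add_monoid (cocycle_ring X)\<^esub> \<phi> \<in> coboundaries X"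
      using \<phi> by (simp add: a_inv_def coboundaries_uminus)
  next
    fix \<phi> \<psi> :: "('a, 'c) cochain" assume "\<phi> \<in> coboundaries X" "\<psi> \<in> coboundaries X"
    then show "\<phi> \<otimes>\<^bsub>add_monoid (cocycle_ring X)\<^esub> \<psi> \<in> coboundaries X"
      by (simp add: cocycle_ring_def coboundaries_add)
  qed
qed (auto simp: cocycle_ring_def coboundaries_cup_left coboundaries_cup_right)

section \<open>Products of lists of cocycles and of their classes\<close>

definition cup_list :: "'a topology \<Rightarrow> ('a, 'c::comm_ring_1) cochain list \<Rightarrow> ('a, 'c) cochain" where
  "cup_list X zs = foldr (cup X) zs (unit_cochain X)"

lemma cocycles_cup_list: "set zs \<subseteq> cocycles X \<Longrightarrow> cup_list X zs \<in> cocycles X"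
  by (induction zs) (auto simp: cup_list_def cocycles_unit cocycles_cup)

lemma cup_list_append:
  "set zs \<subseteq> cocycles X \<Longrightarrow> set ws \<subseteq> cocycles X \<Longrightarrow>
     cup_list X (zs @ ws) = cup X (cup_list X zs) (cup_list X ws)"
proof (induction zs)
  case Nil
  then show ?case
    using cup_unit_left[OF cocycles_cochains[OF cocycles_cup_list[of ws X]]]
    by (simp add: cup_list_def)
qed (simp add: cup_list_def cup_assoc)

text \<open>The passage from classes to cocycles. It is needed because vanishing on the simplices of
  an open set is a property of a chosen representative and makes no sense for a class.\<close>

lemma foldr_mult_cohomology_ring:
  assumes "set zs \<subseteq> cocycles X"
  shows "foldr (mult (cohomology_ring X)) (map (\<lambda>z. coboundaries X +>\<^bsub>cocycle_ring X\<^esub> z) zs)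
           \<one>\<^bsub>cohomology_ring X\<^esub> = coboundaries X +>\<^bsub>cocycle_ring X\<^esub> cup_list X zs"
  using assms
proof (induction zs)
  case Nil
  show ?case
    by (simp add: cup_list_def cohomology_ring_def FactRing_def) (simp add: cocycle_ring_def)
next
  case (Cons z zs)
  interpret ideal "coboundaries X" "cocycle_ring X" by (rule ideal_coboundaries)
  have "z \<in> carrier (cocycle_ring X)" "cup_list X zs \<in> carrier (cocycle_ring X)"
    using Cons.prems cocycles_cup_list[of zs X] by (auto simp: cocycle_ring_def)
  then have "rcoset_mult (cocycle_ring X) (coboundaries X) (coboundaries X +>\<^bsub>cocycle_ring X\<^esub> z)
     (coboundaries X +>\<^bsub>cocycle_ring X\<^esub> cup_list X zs)
     = coboundaries X +>\<^bsub>cocycle_ring X\<^esub> (z \<otimes>\<^bsub>cocycle_ring X\<^esub> cup_list X zs)"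
    by (rule rcoset_mult_add)
  moreover have "z \<otimes>\<^bsub>cocycle_ring X\<^esub> cup_list X zs = cup_list X (z # zs)"
    by (simp add: cup_list_def cocycle_ring_def)
  ultimately show ?case
    using Cons by (simp add: cohomology_ring_def FactRing_def)
qed

lemma coset_eq_zero_iff:
  assumes "z \<in> cocycles X"
  shows "coboundaries X +>\<^bsub>cocycle_ring X\<^esub> z = \<zero>\<^bsub>cohomology_ring X\<^esub> \<longleftrightarrow> z \<in> coboundaries X"
proof -
  interpret ideal "coboundaries X" "cocycle_ring X" by (rule ideal_coboundaries)
  have "z \<in> carrier (cocycle_ring X)"
    using assms by (simp add: cocycle_ring_def)
  then show ?thesis
    using a_rcos_self[of z] a_rcos_const[of z] by (auto simp: cohomology_ring_def FactRing_def)
qed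

text \<open>Permits replacing all factors at once by better representatives, later by ones that
  vanish on members of an open cover.\<close>

lemma cup_list_cohomologous:
  assumes "list_all2 (\<lambda>z w. z \<in> cocycles X \<and> (\<exists>b\<in>coboundaries X. w = (\<lambda>p \<sigma>. b p \<sigma> + z p \<sigma>))) zs ws"
  shows "cup_list X zs \<in> coboundaries X \<longleftrightarrow> cup_list X ws \<in> coboundaries X"
proof -
  interpret ideal "coboundaries X" "cocycle_ring X" by (rule ideal_coboundaries)
  have zs: "set zs \<subseteq> cocycles X"
    using assms by (induction rule: list_all2_induct) auto
  have ws: "set ws \<subseteq> cocycles X"
    using assms
  proof (induction rule: list_all2_induct)
    case (Cons z zs w ws)
    then obtain b where "b \<in> coboundaries X" "w = (\<lambda>p \<sigma>. b p \<sigma> + z p \<sigma>)" "z \<in> cocycles X"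
      by blast
    then have "w \<in> cocycles X"
      using coboundaries_subset_cocycles[of X] by (auto simp: cocycles_add)
    then show ?case using Cons by simp
  qed simp
  have "map (\<lambda>z. coboundaries X +>\<^bsub>cocycle_ring X\<^esub> z) zs = map (\<lambda>z. coboundaries X +>\<^bsub>cocycle_ring X\<^esub> z) ws"
    using assms
  proof (induction rule: list_all2_induct)
    case (Cons z zs w ws)
    obtain b where b: "b \<in> coboundaries X" "w = (\<lambda>p \<sigma>. b p \<sigma> + z p \<sigma>)"
      using Cons by auto
    then have "w \<in> coboundaries X +>\<^bsub>cocycle_ring X\<^esub> z"
      by (auto simp: a_r_coset_def' cocycle_ring_def)
    moreover have "z \<in> carrier (cocycle_ring X)" 
      using Cons by (simp add: cocycle_ring_def)
    ultimately show ?case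
      using a_repr_independence'[of w z] Cons by simp
  qed simp
  then have "coboundaries X +>\<^bsub>cocycle_ring X\<^esub> cup_list X zs = coboundaries X +>\<^bsub>cocycle_ring X\<^esub> cup_list X ws"
    using foldr_mult_cohomology_ring[OF zs] foldr_mult_cohomology_ring[OF ws] by simp
  then show ?thesis
    using coset_eq_zero_iff cocycles_cup_list zs ws by metis
qed

definition positive_cocycles :: "'a topology \<Rightarrow> ('a, 'c::comm_ring_1) cochain set" where
  "positive_cocycles X = {z \<in> cocycles X. \<exists>p>0. \<forall>q \<sigma>. q \<noteq> p \<longrightarrow> z q \<sigma> = 0}"

text \<open>\<open>cohomology_classes\<close> consists by definition of cosets of homogeneous
  cocycles, so choosing such a representative for each class keeps the length of the list and, by
  the coset calculus, the nonvanishing of the product.\<close>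

lemma long_eq_Sup_cocycles:
  "long TYPE('c::comm_ring_1) X = Sup {enat (length zs) | zs :: ('a, 'c) cochain list.
     set zs \<subseteq> positive_cocycles X \<and> cup_list X zs \<notin> coboundaries X}"
proof -
  let ?cos = "\<lambda>z. coboundaries X +>\<^bsub>cocycle_ring X\<^esub> z"
  have classes: "(\<exists>p>0. a \<in> cohomology_classes p X) \<longleftrightarrow> (\<exists>z\<in>positive_cocycles X. a = ?cos z)"
    for a :: "('a, 'c) cochain set"
    by (auto simp: cohomology_classes_def positive_cocycles_def)
  have nz: "foldr (mult (cohomology_ring X)) (map ?cos zs) \<one>\<^bsub>cohomology_ring X\<^esub> \<noteq> \<zero>\<^bsub>cohomology_ring X\<^esub>
      \<longleftrightarrow> cup_list X zs \<notin> coboundaries X" if "set zs \<subseteq> positive_cocycles X"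
    for zs :: "('a, 'c) cochain list"
  proof -
    have "set zs \<subseteq> cocycles X"
      using that by (auto simp: positive_cocycles_def)
    then show ?thesis
      by (simp add: foldr_mult_cohomology_ring coset_eq_zero_iff cocycles_cup_list)
  qed
  have "{enat (length as) | as :: ('a, 'c) cochain set list.
     (\<forall>a\<in>set as. \<exists>p>0. a \<in> cohomology_classes p X) \<and>
     foldr (mult (cohomology_ring X)) as \<one>\<^bsub>cohomology_ring X\<^esub> \<noteq> \<zero>\<^bsub>cohomology_ring X\<^esub>}
    = {enat (length zs) | zs :: ('a, 'c) cochain list.
     set zs \<subseteq> positive_cocycles X \<and> cup_list X zs \<notin> coboundaries X}" (is "?L = ?R")
  proof (intro subset_antisym subsetI)
    fix n assume "n \<in> ?L"
    then obtain as :: "('a, 'c) cochain set list" where as: "n = enat (length as)"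
        "\<forall>a\<in>set as. \<exists>z\<in>positive_cocycles X. a = ?cos z"
        "foldr (mult (cohomology_ring X)) as \<one>\<^bsub>cohomology_ring X\<^esub> \<noteq> \<zero>\<^bsub>cohomology_ring X\<^esub>"
      unfolding classes by auto
    from as(2) obtain r where r: "\<forall>a\<in>set as. r a \<in> positive_cocycles X \<and> a = ?cos (r a)"
      by metis
    have "map ?cos (map r as) = as" "set (map r as) \<subseteq> positive_cocycles X"
      using r by (auto simp: o_def intro!: map_idI)
    then show "n \<in> ?R"
      using nz[of "map r as"] as by (auto intro!: exI[of _ "map r as"])
  next
    fix n assume "n \<in> ?R"
    then obtain zs :: "('a, 'c) cochain list" where
      "n = enat (length zs)" "set zs \<subseteq> positive_cocycles X" "cup_list X zs \<notin> coboundaries X"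
      by auto
    then have "n = enat (length (map ?cos zs))" "\<forall>a\<in>set (map ?cos zs). \<exists>z\<in>positive_cocycles X. a = ?cos z"
      "foldr (mult (cohomology_ring X)) (map ?cos zs) \<one>\<^bsub>cohomology_ring X\<^esub> \<noteq> \<zero>\<^bsub>cohomology_ring X\<^esub>"
      using nz[of zs] by auto
    then show "n \<in> ?L"
      unfolding classes by blast
  qed
  then show ?thesis
    by (simp add: long_def)
qed

section \<open>Functoriality under continuous maps\<close>

definition pullback :: "'a topology \<Rightarrow> ('a \<Rightarrow> 'b) \<Rightarrow> ('b, 'c::comm_ring_1) cochain \<Rightarrow> ('a, 'c) cochain" where
  "pullback X f \<phi> = (\<lambda>p \<sigma>. if singular_simplex p X \<sigma> then \<phi> p (simplex_map p f \<sigma>) else 0)"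

lemma singular_face_simplex_map_commute:
  assumes "p > 0" "k \<le> p"
  shows "singular_face p k (simplex_map p f \<sigma>) = simplex_map (p - 1) f (singular_face p k \<sigma>)"
  using assms
  by (auto simp: singular_face_def simplex_map_def fun_eq_iff simplical_face_in_standard_simplex)

lemma cochains_pullback:
  assumes "\<phi> \<in> cochains Y"
  shows "pullback X f \<phi> \<in> cochains X"
proof -
  have "{p. \<exists>\<sigma>. pullback X f \<phi> p \<sigma> \<noteq> 0} \<subseteq> {p. \<exists>\<sigma>. \<phi> p \<sigma> \<noteq> 0}"
    by (auto simp: pullback_def split: if_splits)
  then have "finite {p. \<exists>\<sigma>. pullback X f \<phi> p \<sigma> \<noteq> 0}"
    using assms by (auto simp: cochains_def intro: finite_subset)
  then show ?thesis
    by (auto simp: cochains_def pullback_def)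
qed

context
  fixes X :: "'a topology" and Y :: "'b topology" and f :: "'a \<Rightarrow> 'b"
  assumes f: "continuous_map X Y f"
begin

lemma pullback_coboundary: "pullback X f (coboundary Y \<phi>) = coboundary X (pullback X f \<phi>)"
proof (intro ext)
  fix p \<sigma>
  show "pullback X f (coboundary Y \<phi>) p \<sigma> = coboundary X (pullback X f \<phi>) p \<sigma>"
  proof (cases "p > 0 \<and> singular_simplex p X \<sigma>")
    case True
    then have "singular_simplex p Y (simplex_map p f \<sigma>)"
      using singular_simplex_simplex_map f by blast
    moreover have "singular_simplex (p - 1) X (singular_face p k \<sigma>)" if "k \<le> p" for k
      using True that singular_simplex_singular_face[of p X \<sigma> k] by simp
    ultimately show ?thesis
      using True by (simp add: pullback_def coboundary_def singular_face_simplex_map_commute)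
  qed (auto simp: pullback_def coboundary_def)
qed

lemma pullback_cup: "pullback X f (cup Y \<phi> \<psi>) = cup X (pullback X f \<phi>) (pullback X f \<psi>)"
proof (intro ext)
  fix n \<sigma>
  show "pullback X f (cup Y \<phi> \<psi>) n \<sigma> = cup X (pullback X f \<phi>) (pullback X f \<psi>) n \<sigma>"
  proof (cases "singular_simplex n X \<sigma>")
    case True
    then have "singular_simplex n Y (simplex_map n f \<sigma>)"
      using singular_simplex_simplex_map f by blast
    moreover have "singular_simplex p X (front_face p \<sigma>)"
        "singular_simplex (n - p) X (back_face p (n - p) \<sigma>)"
        "back_face p (n - p) (simplex_map n f \<sigma>) = simplex_map (n - p) f (back_face p (n - p) \<sigma>)"
      if "p \<le> n" for p
      using True that singular_simplex_front_face[of n X \<sigma> p] singular_simplex_back_face[of p "n - p" X \<sigma>]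
        back_face_simplex_map[of p "n - p" f \<sigma>] by auto
    ultimately show ?thesis
      using True by (simp add: pullback_def cup_def front_face_simplex_map)
  qed (auto simp: pullback_def cup_def)
qed

lemma pullback_unit: "pullback X f (unit_cochain Y) = unit_cochain X"
  using singular_simplex_simplex_map[OF _ f] by (auto simp: pullback_def unit_cochain_def fun_eq_iff)

lemma pullback_cup_list: "pullback X f (cup_list Y zs) = cup_list X (map (pullback X f) zs)"
  by (induction zs) (auto simp: cup_list_def pullback_unit pullback_cup)

lemma cocycles_pullback: "z \<in> cocycles Y \<Longrightarrow> pullback X f z \<in> cocycles X"
  by (auto simp: cocycles_def cochains_pullback pullback_coboundary[symmetric])
     (simp add: pullback_def fun_eq_iff)

lemma positive_cocycles_pullback: "z \<in> positive_cocycles Y \<Longrightarrow> pullback X f z \<in> positive_cocycles X"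
  by (auto simp: positive_cocycles_def cocycles_pullback) (auto simp: pullback_def)

lemma coboundaries_pullback: "z \<in> coboundaries Y \<Longrightarrow> pullback X f z \<in> coboundaries X"
  by (auto simp: coboundaries_def pullback_coboundary cochains_pullback)

lemma pullback_compose: "pullback X f (pullback Y g \<phi>) = pullback X (g \<circ> f) \<phi>"
  using singular_simplex_simplex_map[OF _ f] by (auto simp: pullback_def fun_eq_iff simplex_map_compose)

end

section \<open>Homotopy invariance and small simplices\<close>

text \<open>The cycle is homologous to its image under a constant map, which is a cycle in a
  one-point space. There every cycle bounds in degrees \<open>q \<ge> 1\<close>; in degree
  \<open>0\<close> a point does not, which is why that degree is treated separately below.\<close>

lemma contractible_space_cycle_bounds:
  assumes "contractible_space X" "1 \<le> q" "singular_chain q X c" "chain_boundary q c = 0"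
  obtains e where "singular_chain (Suc q) X e" "chain_boundary (Suc q) e = c"
proof (cases "topspace X = {}")
  case True
  then have "c = 0" using assms(3) singular_chain_empty by blast
  then show ?thesis using that[of 0] by simp
next
  case False
  obtain a where a: "homotopic_with (\<lambda>x. True) X X id (\<lambda>x. a)"
    using assms(1) unfolding contractible_space_def by blast
  then have cont: "continuous_map X X (\<lambda>x. a)" and "a \<in> topspace X"
    using homotopic_with_imp_continuous_maps[OF a] False by (auto simp: continuous_map_def)
  let ?A = "subtopology X {a}"
  have top: "topspace ?A = {a}" using \<open>a \<in> topspace X\<close> by auto
  have c: "singular_relcycle q X {} c" using assms by (simp add: singular_cycle)
  have contA: "continuous_map X ?A (\<lambda>x. a)"
    using cont by (simp add: continuous_map_in_subtopology)
  have "singular_relcycle q ?A {} (chain_map q (\<lambda>x. a) c)"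
    using singular_relcycle_chain_map[OF c contA] by simp
  then have "singular_relboundary q ?A {} (chain_map q (\<lambda>x. a) c)"
    using singular_boundary_eq_cycle_singleton[OF top assms(2)] by blast
  then have "singular_relboundary q X {} (chain_map q (\<lambda>x. a) c)"
    using singular_boundary_mono[of "{a}" "topspace X"] \<open>a \<in> topspace X\<close> by force
  moreover have "homologous_rel q X {} (chain_map q id c) (chain_map q (\<lambda>x. a) c)"
    using homotopic_imp_homologous_rel_chain_maps[of "{}" "{}" X X id "\<lambda>x. a" q c] a c by simp
  ultimately have "singular_relboundary q X {} c"
    unfolding homologous_rel_def chain_map_ident[OF assms(3)]
    using singular_relboundary_add by fastforce
  then show ?thesis
    using that by (auto simp: singular_boundary)
qed

section \<open>The natural chain homotopy between the two ends of a cylinder\<close>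

abbreviation simplex_top :: "nat \<Rightarrow> (nat \<Rightarrow> real) topology" where
  "simplex_top q \<equiv> subtopology (powertop_real UNIV) (standard_simplex q)"

abbreviation cylinder :: "'a topology \<Rightarrow> (real \<times> 'a) topology" where
  "cylinder X \<equiv> prod_topology (top_of_set {0..1}) X"

lemma contractible_space_simplex_top: "contractible_space (simplex_top q)"
proof -
  define e :: "nat \<Rightarrow> real" where "e = (\<lambda>j. if j = 0 then 1 else 0)"
  define h where "h = (\<lambda>(t, x). \<lambda>i. (1 - t) * x i + t * e i)"
  have e: "e \<in> standard_simplex q"
    using basis_in_standard_simplex[of 0 q] by (simp add: e_def)
  have "continuous_map (cylinder (simplex_top q)) euclideanreal (\<lambda>p. h p i)" for i
  proof -
    have "continuous_map (cylinder (simplex_top q)) euclideanreal fst"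
      using continuous_map_fst[of "top_of_set {0..1::real}" "simplex_top q"]
      by (simp add: continuous_map_in_subtopology)
    moreover have "continuous_map (cylinder (simplex_top q)) euclideanreal (\<lambda>p. snd p i)"
    proof -
      have "continuous_map (simplex_top q) euclideanreal (\<lambda>x. x i)"
        by (intro continuous_map_from_subtopology continuous_map_product_projection) auto
      from continuous_map_compose[OF continuous_map_snd this] show ?thesis
        by (simp add: o_def)
    qed
    ultimately show ?thesis
      by (auto simp: h_def case_prod_beta intro!: continuous_intros)
  qed
  then have "continuous_map (cylinder (simplex_top q)) (simplex_top q) h"
    using e convex_standard_simplex[of _ q e]
    by (auto simp: continuous_map_in_subtopology continuous_map_componentwise_UNIV h_def)
  then have "homotopic_with (\<lambda>x. True) (simplex_top q) (simplex_top q) id (\<lambda>x. e)"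
    unfolding homotopic_with_def by (intro exI[of _ h]) (auto simp: h_def)
  then show ?thesis
    unfolding contractible_space_def by blast
qed

lemma contractible_space_cylinder_simplex: "contractible_space (cylinder (simplex_top q))"
  by (auto simp: contractible_space_prod_topology contractible_space_simplex_top
      intro!: convex_imp_contractible)

definition cylinder_map :: "('a \<Rightarrow> 'b) \<Rightarrow> real \<times> 'a \<Rightarrow> real \<times> 'b" where
  "cylinder_map g = (\<lambda>(t, x). (t, g x))"

lemma continuous_map_cylinder_map:
  "continuous_map X Y g \<Longrightarrow> continuous_map (cylinder X) (cylinder Y) (cylinder_map g)"
  unfolding cylinder_map_def continuous_map_prod_top by auto

lemma continuous_map_Pair_cylinder:
  "t \<in> {0..1} \<Longrightarrow> continuous_map X (cylinder X) (Pair t)"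
  by (auto simp: continuous_map_pairwise o_def)

definition identity_simplex :: "nat \<Rightarrow> (nat \<Rightarrow> real) \<Rightarrow> nat \<Rightarrow> real" where
  "identity_simplex q = restrict id (standard_simplex q)"

lemma singular_simplex_identity: "singular_simplex q (simplex_top q) (identity_simplex q)"
  by (simp add: singular_simplex_def identity_simplex_def)

text \<open>A homomorphism from \<open>q\<close>-chains of a space to \<open>(q + 1)\<close>-chains
  of its cylinder that is natural in the space is determined by its value \<open>e\<close> on the
  identity simplex. The formula recovers it from \<open>e\<close>, which plays the role of a
  triangulated prism over the standard simplex.\<close>

definition prism :: "nat \<Rightarrow> (real \<times> (nat \<Rightarrow> real)) chain \<Rightarrow> 'a chain \<Rightarrow> (real \<times> 'a) chain" where
  "prism q e = frag_extend (\<lambda>\<sigma>. chain_map (Suc q) (cylinder_map \<sigma>) e)"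

lemma prism_0 [simp]: "prism q e 0 = 0"
  by (simp add: prism_def)

lemma prism_of [simp]: "prism q e (frag_of \<sigma>) = chain_map (Suc q) (cylinder_map \<sigma>) e"
  by (simp add: prism_def)

lemma prism_diff: "prism q e (a - b) = prism q e a - prism q e b"
  by (simp add: prism_def frag_extend_diff)

context
  fixes q :: nat and e :: "(real \<times> (nat \<Rightarrow> real)) chain"
  assumes e: "singular_chain (Suc q) (cylinder (simplex_top q)) e"
begin

lemma singular_chain_prism:
  assumes "singular_chain q X c"
  shows "singular_chain (Suc q) (cylinder X) (prism q e c)"
  using assms unfolding singular_chain_def[of q]
proof (induction c rule: frag_induction)
  case (one \<sigma>)
  then show ?case
    by (auto simp: singular_simplex_def intro!: singular_chain_chain_map[OF e] continuous_map_cylinder_map)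
qed (auto simp: prism_diff singular_chain_diff)

lemma prism_chain_map:
  assumes "singular_chain q X c"
  shows "prism q e (chain_map q g c) = chain_map (Suc q) (cylinder_map g) (prism q e c)"
  using assms unfolding singular_chain_def[of q]
proof (induction c rule: frag_induction)
  case (one \<sigma>)
  have "chain_map (Suc q) (cylinder_map (simplex_map q g \<sigma>)) e
      = chain_map (Suc q) (cylinder_map g \<circ> cylinder_map \<sigma>) e"
    by (rule chain_map_eq[OF e]) (auto simp: cylinder_map_def simplex_map_def)
  then show ?case
    by (simp add: chain_map_compose)
qed (auto simp: prism_diff chain_map_diff)

text \<open>Naturality: a boundary formula for the model \<open>e\<close> is pushed forward along
  \<open>cylinder_map \<sigma>\<close>. The chain \<open>b\<close> stands for the part of the
  boundary over the faces, which is absent in degree \<open>0\<close>.\<close>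

lemma chain_boundary_prism_simplex:
  assumes "chain_boundary (Suc q) e = chain_map q (Pair 1) (frag_of (identity_simplex q))
      - chain_map q (Pair 0) (frag_of (identity_simplex q)) - b"
    and \<sigma>: "singular_simplex q X \<sigma>"
  shows "chain_boundary (Suc q) (prism q e (frag_of \<sigma>)) = chain_map q (Pair 1) (frag_of \<sigma>)
      - chain_map q (Pair 0) (frag_of \<sigma>) - chain_map q (cylinder_map \<sigma>) b"
proof -
  have "simplex_map q (cylinder_map \<sigma>) (simplex_map q (Pair t) (identity_simplex q))
      = simplex_map q (Pair t) \<sigma>" for t
    by (auto simp: simplex_map_def cylinder_map_def identity_simplex_def)
  then show ?thesis
    using chain_boundary_chain_map[OF e, of "cylinder_map \<sigma>"] by (simp add: assms(1) chain_map_diff)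
qed

end

lemma chain_boundary_prism_0:
  assumes "singular_chain 1 (cylinder (simplex_top 0)) e"
    and "chain_boundary 1 e = chain_map 0 (Pair 1) (frag_of (identity_simplex 0))
      - chain_map 0 (Pair 0) (frag_of (identity_simplex 0))"
    and "singular_chain 0 X c"
  shows "chain_boundary 1 (prism 0 e c) = chain_map 0 (Pair 1) c - chain_map 0 (Pair 0) c"
  using assms(3) unfolding singular_chain_def
proof (induction c rule: frag_induction)
  case (one \<sigma>)
  then show ?case
    using chain_boundary_prism_simplex[of 0 e 0 X \<sigma>] assms(1,2) by simp
qed (auto simp: prism_diff chain_boundary_diff chain_map_diff)

lemma chain_boundary_prism_Suc:
  assumes e: "singular_chain (Suc q) (cylinder (simplex_top q)) e"
    and e': "singular_chain (Suc (Suc q)) (cylinder (simplex_top (Suc q))) e'"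
    and bd: "chain_boundary (Suc (Suc q)) e' = chain_map (Suc q) (Pair 1) (frag_of (identity_simplex (Suc q)))
      - chain_map (Suc q) (Pair 0) (frag_of (identity_simplex (Suc q)))
      - prism q e (chain_boundary (Suc q) (frag_of (identity_simplex (Suc q))))"
    and "singular_chain (Suc q) X c"
  shows "chain_boundary (Suc (Suc q)) (prism (Suc q) e' c)
     = chain_map (Suc q) (Pair 1) c - chain_map (Suc q) (Pair 0) c - prism q e (chain_boundary (Suc q) c)"
  using assms(4) unfolding singular_chain_def[of "Suc q" X]
proof (induction c rule: frag_induction)
  case (one \<sigma>)
  then have \<sigma>: "singular_simplex (Suc q) X \<sigma>" by simp
  let ?i = "frag_of (identity_simplex (Suc q))"
  have i: "singular_chain (Suc q) (simplex_top (Suc q)) ?i"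
    by (simp add: singular_chain_of singular_simplex_identity)
  have "chain_map (Suc q) (cylinder_map \<sigma>) (prism q e (chain_boundary (Suc q) ?i))
      = prism q e (chain_boundary (Suc q) (chain_map (Suc q) \<sigma> ?i))"
    using prism_chain_map[OF e singular_chain_boundary_alt[OF i], of \<sigma>]
      chain_boundary_chain_map[OF i, of \<sigma>] by simp
  also have "chain_map (Suc q) \<sigma> ?i = frag_of \<sigma>"
    unfolding identity_simplex_def by (rule singular_simplex_chain_map_id[OF \<sigma>])
  finally show ?case
    using chain_boundary_prism_simplex[OF e' bd \<sigma>] by simp
qed (auto simp: prism_diff chain_boundary_diff chain_map_diff)

text \<open>The method of acyclic models: the prism of the identity simplex is found degree by degree,
  since its prospective boundary is a cycle in the contractible space \<open>[0,1] \<times> \<Delta>\<^sup>q\<close>.\<close>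

lemma natural_prism_exists:
  obtains e where "\<And>q. singular_chain (Suc q) (cylinder (simplex_top q)) (e q)"
    and "\<And>(X :: 'a topology) q c. singular_chain q X c \<Longrightarrow> chain_boundary (Suc q) (prism q (e q) c)
      = chain_map q (Pair 1) c - chain_map q (Pair 0) c - prism (q - 1) (e (q - 1)) (chain_boundary q c)"
proof -
  let ?i = "\<lambda>q. frag_of (identity_simplex q)"
  have i: "singular_chain q (simplex_top q) (?i q)" for q
    by (simp add: singular_chain_of singular_simplex_identity)
  \<comment> \<open>The clause on cycles of \<open>simplex_top (Suc q)\<close> is what the induction
    consumes: applied to the boundary of the next identity simplex it shows that the prospective
    boundary \<open>?z\<close> is a cycle. The relation between consecutive degrees is recorded in
    \<open>Q\<close>, and the last clause keeps the formula that starts the induction.\<close>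
  define P where "P q e \<longleftrightarrow> singular_chain (Suc q) (cylinder (simplex_top q)) e \<and>
    (\<forall>c. singular_chain q (simplex_top (Suc q)) c \<and> chain_boundary q c = 0 \<longrightarrow>
       chain_boundary (Suc q) (prism q e c) = chain_map q (Pair 1) c - chain_map q (Pair 0) c) \<and>
    (q = 0 \<longrightarrow> chain_boundary 1 e = chain_map 0 (Pair 1) (?i 0) - chain_map 0 (Pair 0) (?i 0))" for q e
  define Q where "Q q e e' \<longleftrightarrow> chain_boundary (Suc (Suc q)) e' = chain_map (Suc q) (Pair 1) (?i (Suc q))
      - chain_map (Suc q) (Pair 0) (?i (Suc q)) - prism q e (chain_boundary (Suc q) (?i (Suc q)))" for q e e'
  have "\<exists>e. P 0 e"
  proof -
    \<comment> \<open>Acyclicity gives nothing in degree \<open>0\<close>. Instead, the identity of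
      the cylinder is itself a homotopy between the two end inclusions, and homotopic maps send the
      vertex to homologous cycles.\<close>
    have "homotopic_with (\<lambda>h. h \<in> {} \<rightarrow> {}) (simplex_top 0) (cylinder (simplex_top 0)) (Pair 1) (Pair 0)"
      unfolding homotopic_with_sym[of _ _ _ "Pair 1"]
      unfolding homotopic_with_def by (intro exI[of _ id]) auto
    moreover have "singular_relcycle 0 (simplex_top 0) {} (?i 0)"
      using i[of 0] by (simp add: singular_cycle chain_boundary_def)
    ultimately have "homologous_rel 0 (cylinder (simplex_top 0)) {} (chain_map 0 (Pair 1) (?i 0)) (chain_map 0 (Pair 0) (?i 0))"
      by (rule homotopic_imp_homologous_rel_chain_maps)
    then obtain e where "singular_chain 1 (cylinder (simplex_top 0)) e"
      "chain_boundary 1 e = chain_map 0 (Pair 1) (?i 0) - chain_map 0 (Pair 0) (?i 0)"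
      unfolding homologous_rel_def singular_boundary by auto
    then have "P 0 e"
      using chain_boundary_prism_0[of e] unfolding P_def by auto
    then show ?thesis ..
  qed
  moreover have "\<exists>e'. P (Suc q) e' \<and> Q q e e'" if "P q e" for q e
  proof -
    have e: "singular_chain (Suc q) (cylinder (simplex_top q)) e"
      using that by (simp add: P_def)
    let ?b = "chain_boundary (Suc q) (?i (Suc q))"
    let ?z = "chain_map (Suc q) (Pair 1) (?i (Suc q)) - chain_map (Suc q) (Pair 0) (?i (Suc q)) - prism q e ?b"
    have b: "singular_chain q (simplex_top (Suc q)) ?b" "chain_boundary q ?b = 0"
      using singular_chain_boundary_alt[OF i] chain_boundary_boundary_alt[OF i] by auto
    have "singular_chain (Suc q) (cylinder (simplex_top (Suc q))) ?z"
      by (intro singular_chain_diff singular_chain_prism[OF e b(1)]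
          singular_chain_chain_map[OF i] continuous_map_Pair_cylinder) auto
    moreover have "chain_boundary (Suc q) ?z = 0"
      using that b chain_boundary_chain_map[OF i[of "Suc q"], of "Pair (1::real)"]
        chain_boundary_chain_map[OF i[of "Suc q"], of "Pair (0::real)"]
      by (simp add: P_def chain_boundary_diff)
    ultimately obtain e' where e': "singular_chain (Suc (Suc q)) (cylinder (simplex_top (Suc q))) e'"
      "chain_boundary (Suc (Suc q)) e' = ?z"
      using contractible_space_cycle_bounds[OF contractible_space_cylinder_simplex] by (metis le_add1 plus_1_eq_Suc)
    have "P (Suc q) e'"
      using chain_boundary_prism_Suc[OF e e'(1) e'(2), of "simplex_top (Suc (Suc q))"] e'(1)
      by (simp add: P_def)
    then show ?thesis
      using e'(2) by (auto simp: Q_def)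
  qed
  ultimately obtain e where e: "\<And>q. P q (e q)" "\<And>q. Q q (e q) (e (Suc q))"
    using dependent_nat_choice[of P Q] by blast
  have 1: "singular_chain (Suc q) (cylinder (simplex_top q)) (e q)" for q
    using e(1) by (simp add: P_def)
  have 2: "chain_boundary (Suc q) (prism q (e q) c) = chain_map q (Pair 1) c - chain_map q (Pair 0) c
      - prism (q - 1) (e (q - 1)) (chain_boundary q c)"
    if c: "singular_chain q X c" for X :: "'a topology" and q c
  proof (cases q)
    \<comment> \<open>Here \<open>q - 1\<close> is \<open>0\<close> again, but the prism is applied
      to \<open>chain_boundary 0 c = 0\<close>, so the formula has the right form.\<close>
    case 0
    then show ?thesis
      using chain_boundary_prism_0[of "e 0" X c] e(1)[of 0] 1[of 0] c by (simp add: P_def chain_boundary_def)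
  next
    case (Suc r)
    then show ?thesis
      using chain_boundary_prism_Suc[OF 1[of r] 1[of "Suc r"]] e(2)[of r] c by (simp add: Q_def)
  qed
  show ?thesis
    by (rule that[of e]) (fact 1, fact 2)
qed

text \<open>Serves for cochains \<open>w\<close> obtained from \<open>z\<close> by dualising a chain
  homotopy, which raises degree by one: finitely many nonzero degrees of \<open>z\<close> leave
  finitely many for \<open>w\<close>.\<close>

lemma cochains_from_next_degree:
  fixes z :: "('a, 'c::comm_ring_1) cochain"
  assumes "z \<in> cochains X"
    and "\<And>p \<sigma>. \<not> singular_simplex p Y \<sigma> \<Longrightarrow> w p \<sigma> = (0::'c)"
    and "\<And>p \<sigma>. (\<And>\<tau>. z (Suc p) \<tau> = 0) \<Longrightarrow> w p \<sigma> = 0"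
  shows "w \<in> cochains Y"
proof -
  have "finite (Suc -` {p. \<exists>\<sigma>. z p \<sigma> \<noteq> 0})"
    using assms(1) by (intro finite_vimageI) (auto simp: cochains_def)
  moreover have "{p. \<exists>\<sigma>. w p \<sigma> \<noteq> 0} \<subseteq> Suc -` {p. \<exists>\<sigma>. z p \<sigma> \<noteq> 0}"
    using assms(3) by blast
  ultimately show ?thesis
    using assms(2) by (auto simp: cochains_def intro: finite_subset)
qed

lemma cocycle_eval_boundary:
  assumes "z \<in> cocycles X" "singular_chain (Suc p) X c"
  shows "cochain_eval (z p) (chain_boundary (Suc p) c) = 0"
  using assms cochain_eval_coboundary[OF assms(2), of z]
  by (simp add: cocycles_def cochain_eval_zero)

text \<open>The difference of the pullbacks is the coboundary of \<open>z\<close> composed with the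
  chain homotopy \<open>K\<close>, because the cocycle \<open>z\<close> is zero on the remaining
  term of the homotopy formula, the boundary of a chain.\<close>

lemma homotopic_pullback_cohomologous:
  fixes X :: "'a topology" and Y :: "'b topology" and z :: "('b, 'c::comm_ring_1) cochain"
  assumes "homotopic_with (\<lambda>_. True) X Y f g" "z \<in> cocycles Y"
  obtains b where "b \<in> coboundaries X" "pullback X g z = (\<lambda>p \<sigma>. b p \<sigma> + pullback X f z p \<sigma>)"
proof -
  obtain h where h: "continuous_map (cylinder X) Y h" "\<And>x. h (0, x) = f x" "\<And>x. h (1, x) = g x"
    using assms(1) unfolding homotopic_with_def by auto
  obtain e where e: "\<And>q. singular_chain (Suc q) (cylinder (simplex_top q)) (e q)"
    and bd: "\<And>(X :: 'a topology) q c. singular_chain q X c \<Longrightarrow> chain_boundary (Suc q) (prism q (e q) c)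
      = chain_map q (Pair 1) c - chain_map q (Pair 0) c - prism (q - 1) (e (q - 1)) (chain_boundary q c)"
    using natural_prism_exists by metis
  define K where "K q c = chain_map (Suc q) h (prism q (e q) c)" for q c
  have K_diff: "K q (a - b) = K q a - K q b" and K_0: "K q 0 = 0" for q a b
    by (simp_all add: K_def prism_diff chain_map_diff)
  have K_bd: "chain_boundary (Suc q) (K q c) = chain_map q g c - chain_map q f c - K (q - 1) (chain_boundary q c)"
    if c: "singular_chain q X c" for q c
  proof -
    have "chain_map q h (chain_map q (Pair 1) c) = chain_map q g c"
      "chain_map q h (chain_map q (Pair 0) c) = chain_map q f c"
      using h(2,3) by (simp_all add: o_def flip: chain_map_compose[THEN fun_cong, unfolded o_apply])
    moreover have "chain_map q h (prism (q - 1) (e (q - 1)) (chain_boundary q c)) = K (q - 1) (chain_boundary q c)"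
      by (cases q) (auto simp: K_def chain_boundary_def)
    ultimately show ?thesis
      using chain_boundary_chain_map[OF singular_chain_prism[OF e c], of h] bd[OF c]
      by (simp add: K_def chain_map_diff)
  qed
  define w where "w q \<sigma> = (if singular_simplex q X \<sigma> then cochain_eval (z (Suc q)) (K q (frag_of \<sigma>)) else 0)" for q \<sigma>
  have "w \<in> cochains X"
    by (rule cochains_from_next_degree[of z Y])
       (use assms in \<open>auto simp: w_def cocycles_cochains intro: cochain_eval_zero\<close>)
  moreover have "pullback X g z = (\<lambda>p \<sigma>. coboundary X w p \<sigma> + pullback X f z p \<sigma>)"
  proof (intro ext)
    fix p \<sigma>
    show "pullback X g z p \<sigma> = coboundary X w p \<sigma> + pullback X f z p \<sigma>"
    proof (cases "singular_simplex p X \<sigma>")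
      case False
      then show ?thesis by (simp add: pullback_def coboundary_def)
    next
      case True
      then have c: "singular_chain p X (frag_of \<sigma>)" by (simp add: singular_chain_of)
      have "singular_chain (Suc p) Y (K p (frag_of \<sigma>))"
        unfolding K_def by (intro singular_chain_chain_map[OF _ h(1)] singular_chain_prism e c)
      then have "cochain_eval (z p) (chain_boundary (Suc p) (K p (frag_of \<sigma>))) = 0"
        using assms(2) by (rule cocycle_eval_boundary[rotated])
      then have "z p (simplex_map p g \<sigma>) - z p (simplex_map p f \<sigma>)
          = cochain_eval (z p) (K (p - 1) (chain_boundary p (frag_of \<sigma>)))"
        unfolding K_bd[OF c] by (simp add: cochain_eval_diff)
      also have "\<dots> = coboundary X w p \<sigma>"
      proof (cases p)
        case 0
        then show ?thesis by (simp add: chain_boundary_def coboundary_def K_0)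
      next
        case (Suc q)
        have "cochain_eval (z p) (K q d) = cochain_eval (w q) d" if "singular_chain q X d" for d
          using that unfolding singular_chain_def
        proof (induction d rule: frag_induction)
          case (one \<tau>)
          then show ?case by (simp add: w_def Suc)
        qed (auto simp: K_0 K_diff cochain_eval_diff)
        then show ?thesis
          using coboundary_eq_cochain_eval[of q X \<sigma> w] True singular_chain_boundary_alt[of q X "frag_of \<sigma>"] c
          by (simp add: Suc)
      qed
      finally show ?thesis
        using True by (simp add: pullback_def algebra_simps)
    qed
  qed
  ultimately show ?thesis
    using that[of "coboundary X w"] by (auto simp: coboundaries_def)
qed

text \<open>The number \<open>N p \<sigma>\<close> of subdivisions after which \<open>\<sigma>\<close> is small differs from that of its faces;
  this is harmless, since on a simplex that is small after \<open>N\<close> subdivisions the chain homotopies for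
  all \<open>m \<ge> N\<close> differ by small chains only.\<close>

lemma cocycle_vanishing_on_small_simplices:
  fixes X :: "'a topology" and z :: "('a, 'c::comm_ring_1) cochain"
  assumes \<C>: "\<And>U. U \<in> \<C> \<Longrightarrow> openin X U" "topspace X \<subseteq> \<Union>\<C>"
    and z: "z \<in> cocycles X"
    and small: "\<And>p U \<sigma>. U \<in> \<C> \<Longrightarrow> singular_simplex p (subtopology X U) \<sigma> \<Longrightarrow> z p \<sigma> = 0"
  shows "z \<in> coboundaries X"
proof -
  let ?sd = "singular_subdivision"
  define S where "S p = {\<sigma>. \<exists>U\<in>\<C>. singular_simplex p (subtopology X U) \<sigma>}" for p
  obtain T :: "nat \<Rightarrow> 'a chain \<Rightarrow> 'a chain" where T0: "\<And>p. T p 0 = 0"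
    and T_diff: "\<And>p c1 c2. T p (c1 - c2) = T p c1 - T p c2"
    and T_chain: "\<And>p X c. singular_chain p X c \<Longrightarrow> singular_chain (Suc p) X (T p c)"
    and T_bd: "\<And>p X c. singular_chain p X c
                 \<Longrightarrow> chain_boundary (Suc p) (T p c) + T (p - Suc 0) (chain_boundary p c) = ?sd p c - c"
    using chain_homotopic_singular_subdivision by metis
  have S_chain: "Poly_Mapping.keys c \<subseteq> S p" if "U \<in> \<C>" "singular_chain p (subtopology X U) c" for U p c
    using that by (auto simp: S_def singular_chain_def)
  have keys_diff': "Poly_Mapping.keys (a - b) \<subseteq> S p"
    if "Poly_Mapping.keys a \<subseteq> S p" "Poly_Mapping.keys b \<subseteq> S p" for a b p
    using that keys_diff[of a b] by blast
  have sd_small: "Poly_Mapping.keys (?sd p c) \<subseteq> S p" if "Poly_Mapping.keys c \<subseteq> S p" for p c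
    using that
  proof (induction c rule: frag_induction)
    case (one \<sigma>)
    then obtain U where "U \<in> \<C>" "singular_chain p (subtopology X U) (frag_of \<sigma>)"
      by (auto simp: S_def singular_chain_of)
    then show ?case
      by (rule S_chain[OF _ singular_chain_singular_subdivision])
  next
    case (diff a b)
    then show ?case by (simp add: singular_subdivision_diff keys_diff')
  qed simp
  have T_small: "Poly_Mapping.keys (T p c) \<subseteq> S (Suc p)" if "Poly_Mapping.keys c \<subseteq> S p" for p c
    using that
  proof (induction c rule: frag_induction)
    case (one \<sigma>)
    then obtain U where "U \<in> \<C>" "singular_chain p (subtopology X U) (frag_of \<sigma>)"
      by (auto simp: S_def singular_chain_of)
    then show ?case
      by (rule S_chain[OF _ T_chain])
  next
    case (diff a b)
    then show ?case by (simp add: T_diff keys_diff')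
  qed (simp add: T0)
  have eval_small: "cochain_eval (z p) c = 0" if "Poly_Mapping.keys c \<subseteq> S p" for p c
    using that small by (intro cochain_eval_zero) (auto simp: S_def)
  have ex_small: "\<exists>n. Poly_Mapping.keys ((?sd p ^^ n) (frag_of \<sigma>)) \<subseteq> S p" if "singular_simplex p X \<sigma>" for p \<sigma>
  proof -
    have c: "singular_chain p X (frag_of \<sigma>)" using that by (simp add: singular_chain_of)
    have chain: "singular_chain p X ((?sd p ^^ n) (frag_of \<sigma>))" for n
      by (induction n) (auto simp: c singular_chain_singular_subdivision)
    obtain n where n: "\<And>m f. \<lbrakk>n \<le> m; f \<in> Poly_Mapping.keys ((?sd p ^^ m) (frag_of \<sigma>))\<rbrakk>
                      \<Longrightarrow> \<exists>V \<in> \<C>. f \<in> (standard_simplex p) \<rightarrow> V"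
      using sufficient_iterated_singular_subdivision_exists[of \<C>, OF \<C> c] by blast
    have "\<tau> \<in> S p" if \<tau>: "\<tau> \<in> Poly_Mapping.keys ((?sd p ^^ n) (frag_of \<sigma>))" for \<tau>
    proof -
      obtain V where "V \<in> \<C>" "\<tau> ` standard_simplex p \<subseteq> V"
        using n[OF order_refl \<tau>] by (auto simp: Pi_iff)
      moreover have "singular_simplex p X \<tau>"
        using chain[of n] \<tau> by (auto simp: singular_chain_def)
      ultimately show ?thesis
        unfolding S_def by (auto simp: singular_simplex_subtopology)
    qed
    then show ?thesis by blast
  qed
  define N where "N p \<sigma> = (SOME n. Poly_Mapping.keys ((?sd p ^^ n) (frag_of \<sigma>)) \<subseteq> S p)" for p \<sigma>
  have N: "Poly_Mapping.keys ((?sd p ^^ n) (frag_of \<sigma>)) \<subseteq> S p" if "singular_simplex p X \<sigma>" "N p \<sigma> \<le> n" for p \<sigma> n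
    using that(2)
  proof (induction n rule: dec_induct)
    case base
    show ?case unfolding N_def using ex_small[OF that(1)] by (rule someI_ex)
  qed (simp add: sd_small)
  \<comment> \<open>Telescoping: adding the homotopies from one subdivision to the next gives a
    chain homotopy from the identity to the \<open>m\<close>-fold subdivision.\<close>
  define H where "H m p c = (\<Sum>i<m. T p ((?sd p ^^ i) c))" for m p c
  have H_diff: "H m p (a - b) = H m p a - H m p b" and H_0: "H m p 0 = 0" for m p a b
    by (simp_all add: H_def singular_subdivision_power_diff T_diff T0 sum_subtractf)
  have sd_chain: "singular_chain p X ((?sd p ^^ i) c)" if "singular_chain p X c" for p i c
    by (induction i) (auto simp: that singular_chain_singular_subdivision)
  have H_chain: "singular_chain (Suc p) X (H m p c)" if "singular_chain p X c" for m p c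
    unfolding H_def by (intro singular_chain_sum T_chain sd_chain that)
  have sd_bd: "chain_boundary p ((?sd p ^^ i) c) = (?sd (p - 1) ^^ i) (chain_boundary p c)"
    if "singular_chain p X c" for p i c
  proof (induction i)
    case (Suc i)
    then show ?case
      using chain_boundary_singular_subdivision[OF sd_chain[OF that, of i]] by simp
  qed simp
  have H_bd: "chain_boundary (Suc p) (H m p c) + H m (p - 1) (chain_boundary p c) = (?sd p ^^ m) c - c"
    if c: "singular_chain p X c" for m p c
  proof (induction m)
    case (Suc m)
    have "chain_boundary (Suc p) (T p ((?sd p ^^ m) c)) + T (p - 1) ((?sd (p - 1) ^^ m) (chain_boundary p c))
        = (?sd p ^^ Suc m) c - (?sd p ^^ m) c"
      using T_bd[OF sd_chain[OF c, of m]] by (simp add: sd_bd[OF c])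
    then have "(chain_boundary (Suc p) (H m p c) + H m (p - 1) (chain_boundary p c))
        + (chain_boundary (Suc p) (T p ((?sd p ^^ m) c)) + T (p - 1) ((?sd (p - 1) ^^ m) (chain_boundary p c)))
        = ((?sd p ^^ m) c - c) + ((?sd p ^^ Suc m) c - (?sd p ^^ m) c)"
      using Suc by simp
    moreover have "H (Suc m) q d = H m q d + T q ((?sd q ^^ m) d)" for q d
      by (simp add: H_def)
    ultimately show ?case
      by (simp only: chain_boundary_add) (simp add: add_ac)
  qed (simp add: H_def)
  have H_indep: "cochain_eval (z (Suc p)) (H m p (frag_of \<sigma>)) = cochain_eval (z (Suc p)) (H (N p \<sigma>) p (frag_of \<sigma>))"
    if "singular_simplex p X \<sigma>" "N p \<sigma> \<le> m" for p \<sigma> m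
    using that(2)
  proof (induction m rule: dec_induct)
    case (step m)
    then show ?case
      using eval_small[OF T_small[OF N[OF that(1), of m]]] by (simp add: H_def cochain_eval_add)
  qed simp
  \<comment> \<open>The minus sign comes from the direction of \<open>H\<close>: its formula yields
    subdivided simplex minus simplex, and \<open>z\<close> vanishes on the subdivided one.\<close>
  define w where "w p \<sigma> = (if singular_simplex p X \<sigma> then - cochain_eval (z (Suc p)) (H (N p \<sigma>) p (frag_of \<sigma>)) else 0)" for p \<sigma>
  have "w \<in> cochains X"
    by (rule cochains_from_next_degree[of z X])
       (use z in \<open>auto simp: w_def cocycles_cochains intro: cochain_eval_zero\<close>)
  moreover have "coboundary X w p \<sigma> = z p \<sigma>" for p \<sigma>
  proof (cases "singular_simplex p X \<sigma>")
    case False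
    then show ?thesis
      using z by (simp add: coboundary_def cocycles_def cochains_def)
  next
    case True
    then have c: "singular_chain p X (frag_of \<sigma>)" by (simp add: singular_chain_of)
    \<comment> \<open>Large enough for \<open>\<sigma>\<close> and for all its faces, so that a
      single homotopy \<open>H m\<close> may replace the individual ones in the coboundary of
      \<open>w\<close>. For \<open>p = 0\<close> the sum has no meaning but only enlarges
      \<open>m\<close>.\<close>
    define m where "m = N p \<sigma> + (\<Sum>k\<le>p. N (p - 1) (singular_face p k \<sigma>))"
    have "cochain_eval (z p) ((?sd p ^^ m) (frag_of \<sigma>) - frag_of \<sigma>)
       = cochain_eval (z p) (H m (p - 1) (chain_boundary p (frag_of \<sigma>)))"
      unfolding H_bd[OF c, symmetric] cochain_eval_add
      using cocycle_eval_boundary[OF z H_chain[OF c]] by simp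
    moreover have "cochain_eval (z p) ((?sd p ^^ m) (frag_of \<sigma>)) = 0"
      by (intro eval_small N True) (simp add: m_def)
    ultimately have "z p \<sigma> = - cochain_eval (z p) (H m (p - 1) (chain_boundary p (frag_of \<sigma>)))"
      by (simp add: cochain_eval_diff) (metis add.inverse_inverse)
    also have "\<dots> = coboundary X w p \<sigma>"
    proof (cases p)
      case 0
      then show ?thesis by (simp add: chain_boundary_def coboundary_def H_0)
    next
      case (Suc q)
      have faces: "singular_simplex q X (singular_face p k \<sigma>)" "N q (singular_face p k \<sigma>) \<le> m" if "k \<le> p" for k
      proof -
        show "singular_simplex q X (singular_face p k \<sigma>)"
          using singular_simplex_singular_face[OF True, of k] that Suc by simp
        have "N q (singular_face p k \<sigma>) \<le> (\<Sum>k\<le>p. N q (singular_face p k \<sigma>))"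
          using that by (intro member_le_sum) auto
        then show "N q (singular_face p k \<sigma>) \<le> m"
          by (simp add: m_def Suc del: sum.atMost_Suc)
      qed
      have "- cochain_eval (z p) (H m q d) = cochain_eval (w q) d"
        if "Poly_Mapping.keys d \<subseteq> {\<tau>. singular_simplex q X \<tau> \<and> N q \<tau> \<le> m}" for d
        using that
      proof (induction d rule: frag_induction)
        case (one \<tau>)
        then show ?case using H_indep[of q \<tau> m] by (simp add: w_def Suc)
      next
        case (diff a b)
        then show ?case by (simp add: H_diff cochain_eval_diff flip: diff)
      qed (simp add: H_0)
      moreover have "Poly_Mapping.keys (chain_boundary p (frag_of \<sigma>)) \<subseteq> {\<tau>. singular_simplex q X \<tau> \<and> N q \<tau> \<le> m}"
      proof -
        have "Poly_Mapping.keys (\<Sum>k\<le>p. frag_cmul ((-1) ^ k) (frag_of (singular_face p k \<sigma>)))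
          \<subseteq> (\<Union>k\<le>p. {singular_face p k \<sigma>})"
          by (rule order_trans[OF keys_sum UN_mono]) auto
        also have "\<dots> \<subseteq> {\<tau>. singular_simplex q X \<tau> \<and> N q \<tau> \<le> m}"
          using faces by blast
        finally show ?thesis
          using Suc by (simp add: chain_boundary_of del: sum.atMost_Suc)
      qed
      ultimately show ?thesis
        using coboundary_eq_cochain_eval[of q X \<sigma> w] True by (simp add: Suc)
    qed
    finally show ?thesis by simp
  qed
  ultimately show ?thesis
    unfolding coboundaries_def by (intro image_eqI[of _ _ w]) (auto simp: fun_eq_iff)
qed

section \<open>Neighbourhood extension of maps into manifolds\<close>

text \<open>Absolute neighbourhood extensors for the regular second countable spaces. The type of their
  points has to be an argument, as one cannot quantify over it.\<close>

definition ane :: "'b itself \<Rightarrow> 'a topology \<Rightarrow> bool" where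
  "ane T Y \<longleftrightarrow> (\<forall>(X :: 'b topology) C f.
     regular_space X \<and> second_countable X \<and> closedin X C \<and> continuous_map (subtopology X C) Y f \<longrightarrow>
     (\<exists>U g. openin X U \<and> C \<subseteq> U \<and> continuous_map (subtopology X U) Y g \<and> (\<forall>x\<in>C. g x = f x)))"

lemma aneD:
  fixes X :: "'b topology"
  assumes "ane TYPE('b) Y" "regular_space X" "second_countable X" "closedin X C"
    "continuous_map (subtopology X C) Y f"
  obtains U g where "openin X U" "C \<subseteq> U" "continuous_map (subtopology X U) Y g" "\<And>x. x \<in> C \<Longrightarrow> g x = f x"
  using assms unfolding ane_def by metis

lemma regular_second_countable_imp_normal_space:
  "regular_space X \<Longrightarrow> second_countable X \<Longrightarrow> normal_space X"
  by (simp add: regular_Lindelof_imp_normal_space second_countable_imp_Lindelof_space)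

lemma continuous_map_closed_Un:
  assumes "closedin X A" "closedin X B"
    and f: "continuous_map (subtopology X A) Y f" and g: "continuous_map (subtopology X B) Y g"
    and fg: "\<And>x. x \<in> A \<Longrightarrow> x \<in> B \<Longrightarrow> f x = g x"
  shows "continuous_map (subtopology X (A \<union> B)) Y (\<lambda>x. if x \<in> A then f x else g x)"
proof (rule pasting_lemma_closed)
  let ?T = "\<lambda>b. if b then A else B" and ?f = "\<lambda>b. if b then f else g"
  show "finite (UNIV :: bool set)" by simp
  show "closedin (subtopology X (A \<union> B)) (?T b)" for b
    using assms(1,2) by (auto intro: closedin_subset_topspace)
  show "continuous_map (subtopology (subtopology X (A \<union> B)) (?T b)) Y (?f b)" for b
    using f g by (simp add: subtopology_subtopology Int_absorb1)
  show "?f i x = ?f j x" if "x \<in> topspace (subtopology X (A \<union> B)) \<inter> ?T i \<inter> ?T j" for i j x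
    using that fg by (auto split: if_splits)
  show "\<exists>j. j \<in> UNIV \<and> x \<in> ?T j \<and> (if x \<in> A then f x else g x) = ?f j x"
    if "x \<in> topspace (subtopology X (A \<union> B))" for x
    using that by (intro exI[of _ "x \<in> A"]) auto
qed

section \<open>Closure properties of neighbourhood extensors\<close>

lemma openin_subtopology_subset: "openin X S \<Longrightarrow> S \<subseteq> T \<Longrightarrow> openin (subtopology X T) S"
  using openin_subtopology_Int[of X S T] by (simp add: Int_absorb2)

lemma ane_open_subset:
  assumes Y: "ane TYPE('b) Y" and V: "openin Y V"
  shows "ane TYPE('b) (subtopology Y V)"
  unfolding ane_def
proof (intro allI impI, elim conjE)
  fix X :: "'b topology" and C f
  assume X: "regular_space X" "second_countable X" "closedin X C"
    and f: "continuous_map (subtopology X C) (subtopology Y V) f"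
  then have f': "continuous_map (subtopology X C) Y f" "f ` C \<subseteq> V"
    using closedin_subset[OF X(3)] by (auto simp: continuous_map_in_subtopology)
  obtain U g where U: "openin X U" "C \<subseteq> U" "continuous_map (subtopology X U) Y g" "\<And>x. x \<in> C \<Longrightarrow> g x = f x"
    using aneD[OF Y X f'(1)] by metis
  define U' where "U' = {x \<in> U. g x \<in> V}"
  have top: "topspace (subtopology X U) = U"
    using openin_subset[OF U(1)] by auto
  have "openin (subtopology X U) U'"
    using openin_continuous_map_preimage[OF U(3) V] unfolding U'_def top .
  then have "openin X U'"
    using U(1) by (rule openin_trans_full)
  moreover have "C \<subseteq> U'"
    using U(2,4) f'(2) by (auto simp: U'_def)
  moreover have "continuous_map (subtopology X U') (subtopology Y V) g"
    using continuous_map_from_subtopology_mono[OF U(3), of U']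
    by (auto simp: continuous_map_in_subtopology U'_def)
  ultimately show "\<exists>U g. openin X U \<and> C \<subseteq> U \<and> continuous_map (subtopology X U) (subtopology Y V) g \<and> (\<forall>x\<in>C. g x = f x)"
    using U(4) by blast
qed

lemma ane_homeomorphic_space:
  assumes "ane TYPE('b) Y" "Y homeomorphic_space Z"
  shows "ane TYPE('b) Z"
  unfolding ane_def
proof (intro allI impI, elim conjE)
  fix X :: "'b topology" and C f
  assume X: "regular_space X" "second_countable X" "closedin X C"
    and f: "continuous_map (subtopology X C) Z f"
  obtain u v where uv: "continuous_map Y Z u" "continuous_map Z Y v" "\<And>z. z \<in> topspace Z \<Longrightarrow> u (v z) = z"
    using assms(2) unfolding homeomorphic_space_def homeomorphic_maps_def by blast
  obtain U g where U: "openin X U" "C \<subseteq> U" "continuous_map (subtopology X U) Y g" "\<And>x. x \<in> C \<Longrightarrow> g x = (v \<circ> f) x"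
    using aneD[OF assms(1) X continuous_map_compose[OF f uv(2)]] by metis
  have "f x \<in> topspace Z" if "x \<in> C" for x
    using f that closedin_subset[OF X(3)] by (auto simp: continuous_map_def)
  then have "(u \<circ> g) x = f x" if "x \<in> C" for x
    using U(4) uv(3) that by simp
  then show "\<exists>U g. openin X U \<and> C \<subseteq> U \<and> continuous_map (subtopology X U) Z g \<and> (\<forall>x\<in>C. g x = f x)"
    using U continuous_map_compose[OF U(3) uv(1)] by blast
qed

text \<open>Tietze's theorem for each coordinate, which even extends over all of \<open>X\<close>.
  The coordinates from \<open>n\<close> on are set to zero to stay inside
  \<open>Euclidean_space n\<close>.\<close>

lemma ane_Euclidean_space: "ane TYPE('b) (Euclidean_space n)"
  unfolding ane_def
proof (intro allI impI, elim conjE)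
  fix X :: "'b topology" and C f
  assume X: "regular_space X" "second_countable X" "closedin X C"
    and f: "continuous_map (subtopology X C) (Euclidean_space n) f"
  have f': "continuous_map (subtopology X C) euclideanreal (\<lambda>x. f x i)" for i
    using f by (auto simp: Euclidean_space_def continuous_map_in_subtopology continuous_map_componentwise_UNIV)
  have f0: "f x i = 0" if "x \<in> C" "i \<ge> n" for x i
    using f that closedin_subset[OF X(3)] by (auto simp: Euclidean_space_def continuous_map_in_subtopology)
  have "\<forall>i. \<exists>g. continuous_map X euclideanreal g \<and> (\<forall>x\<in>C. g x = f x i)"
    using regular_second_countable_imp_normal_space[OF X(1,2)] f' X(3)
    unfolding normal_space_iff_Tietze by blast
  then obtain g where g: "\<And>i. continuous_map X euclideanreal (g i)" "\<And>i x. x \<in> C \<Longrightarrow> g i x = f x i"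
    by metis
  have "continuous_map X (Euclidean_space n) (\<lambda>x i. if i < n then g i x else 0)"
    using g(1) by (auto simp: Euclidean_space_def continuous_map_in_subtopology continuous_map_componentwise_UNIV)
  moreover have "(\<lambda>i. if i < n then g i x else 0) = f x" if "x \<in> C" for x
    using g(2) f0 that by (auto simp: fun_eq_iff)
  ultimately show "\<exists>U g. openin X U \<and> C \<subseteq> U \<and> continuous_map (subtopology X U) (Euclidean_space n) g \<and> (\<forall>x\<in>C. g x = f x)"
    using closedin_subset[OF X(3)]
    by (intro exI[of _ "topspace X"] exI[of _ "\<lambda>x i. if i < n then g i x else 0"]) auto
qed

text \<open>A Urysohn function \<open>s\<close> is \<open>0\<close> where \<open>f\<close> misses
  \<open>W\<close> and \<open>1\<close> where \<open>f\<close> misses \<open>V\<close>. Cutting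
  \<open>X\<close> at the wall \<open>s = 1/2\<close> leaves \<open>f\<close> in \<open>V\<close> on
  one side, in \<open>W\<close> on the other and in \<open>V \<inter> W\<close> on the wall. The
  extension is made on the wall and afterwards, with the wall data prescribed, on each side
  separately, so the two sides match.\<close>

lemma ane_Un:
  assumes V: "openin Y V" "ane TYPE('b) (subtopology Y V)"
    and W: "openin Y W" "ane TYPE('b) (subtopology Y W)" and VW: "topspace Y \<subseteq> V \<union> W"
  shows "ane TYPE('b) Y"
  unfolding ane_def
proof (intro allI impI, elim conjE)
  fix X :: "'b topology" and C f
  assume X: "regular_space X" "second_countable X" "closedin X C"
    and f: "continuous_map (subtopology X C) Y f"
  have CX: "C \<subseteq> topspace X" using X(3) by (rule closedin_subset)
  have fC: "f x \<in> topspace Y" if "x \<in> C" for x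
    using f that CX by (auto simp: continuous_map_def)
  have sub: "regular_space (subtopology X D)" "second_countable (subtopology X D)"
      "normal_space (subtopology X D)" for D
    using X(1,2) by (simp_all add: regular_space_subtopology second_countable_subtopology
        regular_second_countable_imp_normal_space)
  have preimage: "closedin X {x \<in> C. f x \<notin> Z}" if "openin Y Z" for Z
  proof -
    have "closedin (subtopology X C) {x \<in> topspace (subtopology X C). f x \<in> topspace Y - Z}"
      using f that by (intro closedin_continuous_map_preimage) auto
    moreover have "{x \<in> topspace (subtopology X C). f x \<in> topspace Y - Z} = {x \<in> C. f x \<notin> Z}"
      using CX fC by auto
    ultimately show ?thesis
      using X(3) closedin_closed_subtopology by metis
  qed
  have "disjnt {x \<in> C. f x \<notin> W} {x \<in> C. f x \<notin> V}"
    using fC VW by (auto simp: disjnt_iff)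
  then have "\<exists>s. continuous_map X euclideanreal s \<and> s ` {x \<in> C. f x \<notin> W} \<subseteq> {0} \<and> s ` {x \<in> C. f x \<notin> V} \<subseteq> {1}"
    using regular_second_countable_imp_normal_space[OF X(1,2)] preimage[OF V(1)] preimage[OF W(1)]
    unfolding normal_space_iff_Urysohn_alt by simp
  then obtain s where s: "continuous_map X euclideanreal s"
      "\<And>x. x \<in> C \<Longrightarrow> f x \<notin> W \<Longrightarrow> s x = 0" "\<And>x. x \<in> C \<Longrightarrow> f x \<notin> V \<Longrightarrow> s x = 1"
    by (auto simp: image_subset_iff)
  define Xm where "Xm = {x \<in> topspace X. s x \<in> {..1/2}}"
  define Xp where "Xp = {x \<in> topspace X. s x \<in> {1/2..}}"
  define X0 where "X0 = {x \<in> topspace X. s x \<in> {1/2}}"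
  have closed: "closedin X Xm" "closedin X Xp" "closedin X X0"
    unfolding Xm_def Xp_def X0_def by (intro closedin_continuous_map_preimage[OF s(1)]; simp)+
  have fV: "f x \<in> V" if "x \<in> C" "x \<in> Xm" for x
    using that s(3)[of x] by (auto simp: Xm_def)
  have fW: "f x \<in> W" if "x \<in> C" "x \<in> Xp" for x
    using that s(2)[of x] by (auto simp: Xp_def)
  have X0: "X0 = Xm \<inter> Xp" and Xmp: "topspace X = Xm \<union> Xp"
    by (auto simp: Xm_def Xp_def X0_def)
  have f_into: "continuous_map (subtopology X (C \<inter> D)) (subtopology Y Z) f"
    if "\<And>x. x \<in> C \<inter> D \<Longrightarrow> f x \<in> Z" for D Z
    using that continuous_map_from_subtopology_mono[OF f, of "C \<inter> D"]
    by (auto simp: continuous_map_in_subtopology)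
  have "ane TYPE('b) (subtopology Y (V \<inter> W))"
    using ane_open_subset[OF V(2), of "V \<inter> W"] V(1) W(1)
    by (simp add: subtopology_subtopology openin_subtopology_Int openin_open_subtopology openin_Int)
  moreover have "closedin (subtopology X X0) (C \<inter> X0)"
    using X(3) by (metis inf_commute closedin_subtopology_Int_closed)
  moreover have "continuous_map (subtopology (subtopology X X0) (C \<inter> X0)) (subtopology Y (V \<inter> W)) f"
  proof -
    have "f x \<in> V \<inter> W" if "x \<in> C \<inter> X0" for x
      using that fV fW X0 by blast
    then have "continuous_map (subtopology X (C \<inter> X0)) (subtopology Y (V \<inter> W)) f"
      by (rule f_into)
    then show ?thesis by (simp add: subtopology_subtopology Int_absorb1)
  qed
  ultimately obtain U0 g0 where U0: "openin (subtopology X X0) U0" "C \<inter> X0 \<subseteq> U0"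
    and g0: "continuous_map (subtopology (subtopology X X0) U0) (subtopology Y (V \<inter> W)) g0"
      "\<And>x. x \<in> C \<inter> X0 \<Longrightarrow> g0 x = f x"
    using aneD[OF _ sub(1,2)] by metis
  have "closedin (subtopology X X0) (C \<inter> X0)"
    using X(3) by (metis inf_commute closedin_subtopology_Int_closed)
  \<comment> \<open>The extension \<open>g0\<close> lives on a relatively open part of the wall,
    while the data for the next extension must sit on a closed set; normality provides the closed
    neighbourhood \<open>K0\<close> of \<open>C \<inter> X0\<close> inside it.\<close>
  then obtain W0 where W0: "openin (subtopology X X0) W0" "C \<inter> X0 \<subseteq> W0"
      "(subtopology X X0) closure_of W0 \<subseteq> U0"
    using sub(3)[of X0] U0 unfolding normal_space_alt by metis
  define K0 where "K0 = (subtopology X X0) closure_of W0"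
  have K0: "closedin X K0" "K0 \<subseteq> X0" "W0 \<subseteq> K0" "K0 \<subseteq> U0"
  proof -
    have "closedin (subtopology X X0) K0"
      by (simp add: K0_def)
    then show "closedin X K0" "K0 \<subseteq> X0"
      using closed(3) closedin_closed_subtopology by metis+
    show "W0 \<subseteq> K0"
      unfolding K0_def using openin_subset[OF W0(1)] by (rule closure_of_subset)
    show "K0 \<subseteq> U0"
      using W0(3) by (simp add: K0_def)
  qed
  have g0_K0: "continuous_map (subtopology X K0) (subtopology Y (V \<inter> W)) g0"
  proof -
    have "subtopology X K0 = subtopology (subtopology (subtopology X X0) U0) K0"
      using K0 by (simp add: subtopology_subtopology Int_absorb1 Int_absorb2)
    then show ?thesis
      using g0(1) continuous_map_from_subtopology by metis
  qed
  \<comment> \<open>Used for \<open>D = Xm\<close>, \<open>Z = V\<close> and for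
    \<open>D = Xp\<close>, \<open>Z = W\<close>: on each side the data are \<open>g0\<close> on
    \<open>K0\<close> and \<open>f\<close> on \<open>C\<close>.\<close>
  have side: "\<exists>U g. openin (subtopology X D) U \<and> C \<inter> D \<subseteq> U \<and> K0 \<subseteq> U \<and> continuous_map (subtopology X U) Y g
      \<and> (\<forall>x\<in>C \<inter> D. g x = f x) \<and> (\<forall>x\<in>K0. g x = g0 x)"
    if D: "closedin X D" "X0 \<subseteq> D" and Z: "V \<inter> W \<subseteq> Z" "ane TYPE('b) (subtopology Y Z)"
      and fZ: "\<And>x. x \<in> C \<inter> D \<Longrightarrow> f x \<in> Z" for D Z
  proof -
    have "continuous_map (subtopology X K0) (subtopology Y Z) g0"
      using g0_K0 Z(1) by (auto simp: continuous_map_in_subtopology)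
    moreover have "closedin X (C \<inter> D)"
      using X(3) D(1) by (rule closedin_Int)
    moreover have "g0 x = f x" if "x \<in> K0" "x \<in> C \<inter> D" for x
      using that K0(2) g0(2) by auto
    moreover define h where "h = (\<lambda>x. if x \<in> K0 then g0 x else f x)"
    ultimately have h: "continuous_map (subtopology X (K0 \<union> C \<inter> D)) (subtopology Y Z) h"
      unfolding h_def using K0(1) f_into[OF fZ] by (intro continuous_map_closed_Un) auto
    have KD: "K0 \<union> C \<inter> D \<subseteq> D" using K0(2) D(2) by blast
    have cl: "closedin (subtopology X D) (K0 \<union> C \<inter> D)"
      using KD K0(1) X(3) D(1) by (intro closedin_subset_topspace closedin_Un closedin_Int) auto
    have "continuous_map (subtopology (subtopology X D) (K0 \<union> C \<inter> D)) (subtopology Y Z) h"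
      using h KD by (simp add: subtopology_subtopology Int_absorb1)
    then obtain U g where U: "openin (subtopology X D) U" "K0 \<union> C \<inter> D \<subseteq> U"
        "continuous_map (subtopology (subtopology X D) U) (subtopology Y Z) g"
        "\<And>x. x \<in> K0 \<union> C \<inter> D \<Longrightarrow> g x = h x"
      using aneD[OF Z(2) sub(1,2) cl] by metis
    have "U \<subseteq> D"
      using openin_subset[OF U(1)] by auto
    then have "continuous_map (subtopology X U) Y g"
      using U(3) by (simp add: subtopology_subtopology Int_absorb1 continuous_map_in_subtopology)
    moreover have "g x = f x" if "x \<in> C \<inter> D" for x
      using U(4)[of x] that K0(2) g0(2)[of x] by (auto simp: h_def)
    moreover have "g x = g0 x" if "x \<in> K0" for x
      using U(4)[of x] that by (simp add: h_def)
    ultimately show ?thesis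
      using U(1,2) by (intro exI[of _ U] exI[of _ g]) auto
  qed
  obtain Um gm where Um: "openin (subtopology X Xm) Um" "C \<inter> Xm \<subseteq> Um" "K0 \<subseteq> Um"
    "continuous_map (subtopology X Um) Y gm" "\<forall>x\<in>C \<inter> Xm. gm x = f x" "\<forall>x\<in>K0. gm x = g0 x"
    using side[OF closed(1) _ _ V(2)] X0 fV by auto
  obtain Up gp where Up: "openin (subtopology X Xp) Up" "C \<inter> Xp \<subseteq> Up" "K0 \<subseteq> Up"
    "continuous_map (subtopology X Up) Y gp" "\<forall>x\<in>C \<inter> Xp. gp x = f x" "\<forall>x\<in>K0. gp x = g0 x"
    using side[OF closed(2) _ _ W(2)] X0 fW by auto
  have subs: "Um \<subseteq> Xm" "Up \<subseteq> Xp" "W0 \<subseteq> X0"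
    using openin_subset[OF Um(1)] openin_subset[OF Up(1)] openin_subset[OF W0(1)] by auto
  \<comment> \<open>\<open>Um\<close> and \<open>Up\<close> are open only within their sides.
    Without the wall points outside \<open>W0\<close> they meet just in \<open>W0\<close>, where
    both extensions equal \<open>g0\<close>, and the complement of the union is the union of the
    closed sets \<open>Xm - Um\<close>, \<open>Xp - Up\<close> and \<open>X0 - W0\<close>.\<close>
  define U where "U = (Um - (X0 - W0)) \<union> (Up - (X0 - W0))"
  have UX: "U \<subseteq> topspace X" using subs Xmp by (auto simp: U_def)
  have Um_eq: "U \<inter> Xm = Um - (X0 - W0)" and Up_eq: "U \<inter> Xp = Up - (X0 - W0)"
    using subs K0(3) Um(3) Up(3) X0 by (auto simp: U_def)
  have compl: "closedin X (D - A)" if "closedin X D" "openin (subtopology X D) A" for D A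
  proof -
    have "closedin (subtopology X D) (topspace (subtopology X D) - A)"
      using that(2) by blast
    moreover have "topspace (subtopology X D) = D"
      using closedin_subset[OF that(1)] by auto
    ultimately show ?thesis
      using that(1) closedin_closed_subtopology by metis
  qed
  have "topspace X - U = (Xm - Um) \<union> (Xp - Up) \<union> (X0 - W0)"
    using Um_eq Up_eq Xmp X0 by blast
  then have "closedin X (topspace X - U)"
    using compl[OF closed(1) Um(1)] compl[OF closed(2) Up(1)] compl[OF closed(3) W0(1)]
    by (simp add: closedin_Un)
  then have openU: "openin X U"
    using UX by (simp add: openin_closedin_eq)
  moreover have CU: "C \<subseteq> U"
    using CX Xmp Um(2) Up(2) W0(2) unfolding U_def by blast
  moreover have "continuous_map (subtopology X U) Y (\<lambda>x. if x \<in> U \<inter> Xm then gm x else gp x)"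
  proof -
    let ?XU = "subtopology X U"
    have XU: "subtopology ?XU (U \<inter> D) = subtopology X (U \<inter> D)" for D
      by (simp add: subtopology_subtopology)
    have "continuous_map (subtopology ?XU ((U \<inter> Xm) \<union> (U \<inter> Xp))) Y (\<lambda>x. if x \<in> U \<inter> Xm then gm x else gp x)"
    proof (rule continuous_map_closed_Un)
      show "closedin ?XU (U \<inter> Xm)" "closedin ?XU (U \<inter> Xp)"
        using closed by (simp_all add: closedin_subtopology_Int_closed)
      show "continuous_map (subtopology ?XU (U \<inter> Xm)) Y gm"
        unfolding XU by (rule continuous_map_from_subtopology_mono[OF Um(4)]) (auto simp: Um_eq)
      show "continuous_map (subtopology ?XU (U \<inter> Xp)) Y gp"
        unfolding XU by (rule continuous_map_from_subtopology_mono[OF Up(4)]) (auto simp: Up_eq)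
      show "gm x = gp x" if "x \<in> U \<inter> Xm" "x \<in> U \<inter> Xp" for x
      proof -
        have "x \<in> W0" using that X0 by (auto simp: U_def)
        then show ?thesis using K0(3) Um(6) Up(6) by auto
      qed
    qed
    moreover have "(U \<inter> Xm) \<union> (U \<inter> Xp) = U" using UX Xmp by blast
    ultimately show ?thesis by (simp add: subtopology_subtopology)
  qed
  moreover have "\<forall>x\<in>C. (if x \<in> U \<inter> Xm then gm x else gp x) = f x"
    using CU CX Xmp Um(5) Up(5) by auto
  ultimately show "\<exists>U g. openin X U \<and> C \<subseteq> U \<and> continuous_map (subtopology X U) Y g \<and> (\<forall>x\<in>C. g x = f x)"
    by blast
qed

lemma ane_trivial_topology: "ane TYPE('b) trivial_topology"
  unfolding ane_def
proof (intro allI impI, elim conjE)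
  fix X :: "'b topology" and C and f :: "'b \<Rightarrow> 'a"
  assume "closedin X C" and "continuous_map (subtopology X C) trivial_topology f"
  then have "C = {}"
    using closedin_subset[of X C] by (auto simp: subtopology_trivial_iff)
  then show "\<exists>U g. openin X U \<and> C \<subseteq> U \<and> continuous_map (subtopology X U) (trivial_topology :: 'a topology) g \<and> (\<forall>x\<in>C. g x = f x)"
    by (intro exI[of _ "{}"] exI[of _ f]) auto
qed

lemma ane_finite_Union:
  assumes "\<And>i. openin Y (V i)" "\<And>i. ane TYPE('b) (subtopology Y (V i))"
  shows "ane TYPE('b) (subtopology Y (\<Union>i<n::nat. V i))"
proof (induction n)
  case 0
  then show ?case by (simp add: ane_trivial_topology)
next
  case (Suc n)
  let ?Y = "subtopology Y (\<Union>i<Suc n. V i)"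
  have eq: "(\<Union>i<Suc n. V i) = (\<Union>i<n. V i) \<union> V n"
    by (auto simp: less_Suc_eq)
  show ?case
  proof (rule ane_Un)
    show "openin ?Y (\<Union>i<n. V i)" "openin ?Y (V n)"
      using assms(1) by (auto simp: eq intro!: openin_subtopology_subset openin_Union)
    show "ane TYPE('b) (subtopology ?Y (\<Union>i<n. V i))" "ane TYPE('b) (subtopology ?Y (V n))"
      using Suc assms(2) by (simp_all add: eq subtopology_subtopology Int_absorb1)
  qed (auto simp: eq)
qed

text \<open>The extensions over different shells can be pasted only if their domains in
  \<open>X\<close> are disjoint. A Tietze extension \<open>\<rho>\<close> of
  \<open>r \<circ> f\<close> achieves this: the shells of \<open>\<rho>\<close> are disjoint open
  sets, since the centres \<open>2 * k\<close> are two apart, and they cover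
  \<open>C\<close>.\<close>

lemma ane_disjoint_shells:
  assumes r: "continuous_map Y euclideanreal r"
    and shells: "\<And>y. y \<in> topspace Y \<Longrightarrow> \<exists>k::nat. \<bar>r y - 2 * real k\<bar> < 1"
    and ane: "\<And>k::nat. ane TYPE('b) (subtopology Y {y \<in> topspace Y. \<bar>r y - 2 * real k\<bar> < 1})"
  shows "ane TYPE('b) Y"
  unfolding ane_def
proof (intro allI impI, elim conjE)
  fix X :: "'b topology" and C f
  assume X: "regular_space X" "second_countable X" "closedin X C"
    and f: "continuous_map (subtopology X C) Y f"
  have CX: "C \<subseteq> topspace X" using X(3) by (rule closedin_subset)
  have fC: "f x \<in> topspace Y" if "x \<in> C" for x
    using f that CX by (auto simp: continuous_map_def)
  obtain \<rho> where \<rho>: "continuous_map X euclideanreal \<rho>" "\<And>x. x \<in> C \<Longrightarrow> \<rho> x = r (f x)"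
    using regular_second_countable_imp_normal_space[OF X(1,2)] X(3) continuous_map_compose[OF f r]
    unfolding normal_space_iff_Tietze by (metis comp_apply)
  define S where "S k = {x \<in> topspace X. \<bar>\<rho> x - 2 * real k\<bar> < 1}" for k
  define S' where "S' k = {y \<in> topspace Y. \<bar>r y - 2 * real k\<bar> < 1}" for k
  have S_open: "openin X (S k)" for k
  proof -
    have "openin X {x \<in> topspace X. \<rho> x \<in> {2 * real k - 1<..<2 * real k + 1}}"
      using \<rho>(1) by (intro openin_continuous_map_preimage) auto
    moreover have "{x \<in> topspace X. \<rho> x \<in> {2 * real k - 1<..<2 * real k + 1}} = S k"
      by (auto simp: S_def abs_less_iff)
    ultimately show ?thesis by simp
  qed
  have S_disjoint: "j = k" if "x \<in> S j" "x \<in> S k" for x j k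
    using that by (auto simp: S_def)
  have "\<exists>U g. openin X U \<and> U \<subseteq> S k \<and> C \<inter> S k \<subseteq> U \<and> continuous_map (subtopology X U) Y g \<and> (\<forall>x\<in>C \<inter> S k. g x = f x)" for k
  proof -
    have "f x \<in> S' k" if "x \<in> C \<inter> S k" for x
      using that fC \<rho>(2) by (auto simp: S_def S'_def)
    then have "continuous_map (subtopology (subtopology X (S k)) (C \<inter> S k)) (subtopology Y (S' k)) f"
      using continuous_map_from_subtopology_mono[OF f, of "C \<inter> S k"]
      by (auto simp: subtopology_subtopology Int_absorb1 continuous_map_in_subtopology)
    moreover have "closedin (subtopology X (S k)) (C \<inter> S k)"
      using X(3) by (metis inf_commute closedin_subtopology_Int_closed)
    moreover have "ane TYPE('b) (subtopology Y (S' k))"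
      using ane[of k] by (simp add: S'_def)
    ultimately obtain U g where U: "openin (subtopology X (S k)) U" "C \<inter> S k \<subseteq> U"
      "continuous_map (subtopology (subtopology X (S k)) U) (subtopology Y (S' k)) g" "\<And>x. x \<in> C \<inter> S k \<Longrightarrow> g x = f x"
      using aneD[of "subtopology Y (S' k)" "subtopology X (S k)" "C \<inter> S k" f] X(1,2)
      by (metis regular_space_subtopology second_countable_subtopology)
    have "U \<subseteq> S k" using openin_subset[OF U(1)] by auto
    then show ?thesis
      using U openin_trans_full[OF U(1) S_open]
      by (intro exI[of _ U] exI[of _ g]) (auto simp: subtopology_subtopology Int_absorb1 continuous_map_in_subtopology)
  qed
  then obtain U g where U: "\<And>k. openin X (U k)" "\<And>k. U k \<subseteq> S k" "\<And>k. C \<inter> S k \<subseteq> U k"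
      "\<And>k. continuous_map (subtopology X (U k)) Y (g k)" "\<And>k x. x \<in> C \<inter> S k \<Longrightarrow> g k x = f x"
    by metis
  let ?U = "\<Union>k. U k"
  have "\<exists>h. continuous_map (subtopology X ?U) Y h \<and> (\<forall>k x. x \<in> U k \<longrightarrow> h x = g k x)"
  proof (rule pasting_lemma_exists[where X = "subtopology X ?U" and I = UNIV and T = U and Y = Y and f = g])
    show "openin (subtopology X ?U) (U k)" for k
      using U(1) by (intro openin_subtopology_subset) auto
    show "continuous_map (subtopology (subtopology X ?U) (U k)) Y (g k)" for k
      using U(4)[of k] by (simp add: subtopology_subtopology Int_absorb1 UN_upper)
    show "g i x = g j x" if "x \<in> topspace (subtopology X ?U) \<inter> U i \<inter> U j" for i j x
      using that S_disjoint[of x i j] U(2) by blast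
    fix h assume 1: "continuous_map (subtopology X ?U) Y h"
      and h: "\<And>x i. i \<in> UNIV \<Longrightarrow> x \<in> topspace (subtopology X ?U) \<inter> U i \<Longrightarrow> h x = g i x"
    have "h x = g i x" if "x \<in> U i" for x i
      by (rule h) (use that openin_subset[OF U(1)[of i]] in auto)
    with 1 show ?thesis
      by auto
  qed auto
  then obtain h where h: "continuous_map (subtopology X ?U) Y h" "\<And>k x. x \<in> U k \<Longrightarrow> h x = g k x"
    by blast
  have "x \<in> ?U \<and> h x = f x" if x: "x \<in> C" for x
  proof -
    obtain k :: nat where "\<bar>r (f x) - 2 * real k\<bar> < 1"
      using shells[OF fC[OF x]] by blast
    then have "x \<in> C \<inter> S k"
      using x CX \<rho>(2)[OF x] by (auto simp: S_def)
    then show ?thesis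
      using U(3)[of k] h(2)[of x k] U(5)[of x k] by auto
  qed
  then show "\<exists>U g. openin X U \<and> C \<subseteq> U \<and> continuous_map (subtopology X U) Y g \<and> (\<forall>x\<in>C. g x = f x)"
    using h(1) U(1) by (intro exI[of _ ?U] exI[of _ h]) auto
qed

text \<open>The Weierstrass test with a geometric majorant, whose tail from \<open>n\<close> on sums
  to \<open>2 * (1/2) ^ n\<close>. This bound also makes the sum small wherever its first
  \<open>n\<close> terms vanish.\<close>

lemma continuous_map_weighted_sum:
  assumes "\<And>i::nat. continuous_map X euclideanreal (\<psi> i)" "\<And>i x. x \<in> topspace X \<Longrightarrow> \<psi> i x \<in> {0..1}"
  shows "continuous_map X euclideanreal (\<lambda>x. suminf (\<lambda>i. \<psi> i x * (1/2) ^ i))"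
    and "\<And>x n. x \<in> topspace X \<Longrightarrow> \<bar>suminf (\<lambda>i. \<psi> i x * (1/2) ^ i) - (\<Sum>i<n. \<psi> i x * (1/2) ^ i)\<bar> \<le> 2 * (1/2) ^ n"
    and "\<And>x i. x \<in> topspace X \<Longrightarrow> \<psi> i x * (1/2) ^ i \<le> suminf (\<lambda>i. \<psi> i x * (1/2) ^ i)"
proof -
  have geo: "summable (\<lambda>i. (1/2::real) ^ i)" by (simp add: summable_geometric)
  have le: "\<bar>\<psi> i x * (1/2) ^ i\<bar> \<le> (1/2) ^ i" if "x \<in> topspace X" for x i
    using assms(2)[OF that, of i] by (simp add: abs_mult mult_left_le_one_le)
  have sm: "summable (\<lambda>i. \<psi> i x * (1/2) ^ i)" if "x \<in> topspace X" for x
    by (rule summable_comparison_test'[OF geo]) (use le[OF that] in auto)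
  show tail: "\<bar>suminf (\<lambda>i. \<psi> i x * (1/2) ^ i) - (\<Sum>i<n. \<psi> i x * (1/2) ^ i)\<bar> \<le> 2 * (1/2) ^ n"
    if x: "x \<in> topspace X" for x n
  proof -
    have "suminf (\<lambda>i. \<psi> i x * (1/2) ^ i) - (\<Sum>i<n. \<psi> i x * (1/2) ^ i) = suminf (\<lambda>i. \<psi> (i + n) x * (1/2) ^ (i + n))"
      using suminf_minus_initial_segment[OF sm[OF x], of n] by simp
    also have "\<bar>\<dots>\<bar> \<le> suminf (\<lambda>i. (1/2) ^ (i + n))"
      using norm_suminf_le[of "\<lambda>i. \<psi> (i + n) x * (1/2) ^ (i + n)" "\<lambda>i. (1/2) ^ (i + n)"]
        le[OF x] geo by (simp add: summable_ignore_initial_segment)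
    also have "suminf (\<lambda>i. (1/2::real) ^ (i + n)) = 2 * (1/2) ^ n"
      using suminf_mult2[OF geo, of "(1/2) ^ n"] suminf_geometric[of "1/2::real"] by (simp add: power_add)
    finally show ?thesis .
  qed
  show "\<psi> i x * (1/2) ^ i \<le> suminf (\<lambda>i. \<psi> i x * (1/2) ^ i)" if x: "x \<in> topspace X" for x i
    using sum_le_suminf[OF sm[OF x], of "{i}"] assms(2)[OF x] by auto
  have "continuous_map X Met_TC.mtopology (\<lambda>x. suminf (\<lambda>i. \<psi> i x * (1/2) ^ i))"
  proof (rule Met_TC.continuous_map_uniform_limit[where F = sequentially and f = "\<lambda>n x. \<Sum>i<n. \<psi> i x * (1/2) ^ i"])
    show "\<forall>\<^sub>F n in sequentially. continuous_map X Met_TC.mtopology (\<lambda>x. \<Sum>i<n. \<psi> i x * (1/2) ^ i)"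
      using assms(1) by (intro always_eventually allI) (auto intro!: continuous_intros)
    fix \<epsilon> :: real assume "\<epsilon> > 0"
    have "(\<lambda>n. 2 * (1/2::real) ^ n) \<longlonglongrightarrow> 2 * 0"
      by (intro tendsto_mult tendsto_const LIMSEQ_power_zero) auto
    then have "\<forall>\<^sub>F n in sequentially. 2 * (1/2) ^ n < \<epsilon>"
      using \<open>\<epsilon> > 0\<close> order_tendstoD(2) by fastforce
    then show "\<forall>\<^sub>F n in sequentially. \<forall>x\<in>topspace X. suminf (\<lambda>i. \<psi> i x * (1/2) ^ i) \<in> UNIV \<and>
        dist (\<Sum>i<n. \<psi> i x * (1/2) ^ i) (suminf (\<lambda>i. \<psi> i x * (1/2) ^ i)) < \<epsilon>"
    proof eventually_elim
      case (elim n)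
      then show ?case
        using tail[of _ n] by (force simp: dist_real_def abs_minus_commute)
    qed
  qed auto
  then show "continuous_map X euclideanreal (\<lambda>x. suminf (\<lambda>i. \<psi> i x * (1/2) ^ i))" by simp
qed

text \<open>A weighted sum of bump functions has a reciprocal \<open>r : Y \<rightarrow> (0, \<infinity>)\<close> whose sublevel sets
  are covered by finitely many of the given open sets. The shells \<open>\<bar>r - m\<bar> < 1\<close> with \<open>m\<close> even are
  disjoint, those with \<open>m\<close> odd as well, and together they cover \<open>Y\<close>.\<close>

lemma ane_locally:
  assumes Y: "completely_regular_space Y" "Lindelof_space Y"
    and loc: "\<And>y. y \<in> topspace Y \<Longrightarrow> \<exists>V. openin Y V \<and> y \<in> V \<and> ane TYPE('b) (subtopology Y V)"
  shows "ane TYPE('b) Y"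
proof (cases "topspace Y = {}")
  case True
  then show ?thesis by (simp add: ane_trivial_topology)
next
  case False
  define bump where "bump y V \<psi> \<longleftrightarrow> openin Y V \<and> ane TYPE('b) (subtopology Y V) \<and>
     continuous_map Y euclideanreal \<psi> \<and> (\<forall>x\<in>topspace Y. \<psi> x \<in> {0..1}) \<and> \<psi> y > (0::real) \<and>
     (\<forall>x\<in>topspace Y. \<psi> x > 0 \<longrightarrow> x \<in> V)" for y V \<psi>
  have "\<exists>V \<psi>. bump y V \<psi>" if y: "y \<in> topspace Y" for y
  proof -
    obtain V where V: "openin Y V" "y \<in> V" "ane TYPE('b) (subtopology Y V)"
      using loc[OF y] by blast
    have "closedin Y (topspace Y - V)" "y \<in> topspace Y - (topspace Y - V)"
      using V y by auto
    then obtain \<phi> :: "'a \<Rightarrow> real" where \<phi>: "continuous_map Y (top_of_set {0..1}) \<phi>" "\<phi> y = 0" "\<phi> ` (topspace Y - V) \<subseteq> {1}"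
      using Y(1) unfolding completely_regular_space_def by blast
    have "continuous_map Y euclideanreal (\<lambda>x. 1 - \<phi> x)"
      using \<phi>(1) by (auto simp: continuous_map_in_subtopology intro!: continuous_intros)
    moreover have "\<forall>x\<in>topspace Y. 1 - \<phi> x \<in> {0..1}"
      using \<phi>(1) by (auto simp: continuous_map_in_subtopology image_subset_iff)
    ultimately have "bump y V (\<lambda>x. 1 - \<phi> x)"
      using V \<phi>(2,3) unfolding bump_def by (fastforce simp: image_subset_iff)
    then show ?thesis by blast
  qed
  then obtain V \<psi> where "\<And>y. y \<in> topspace Y \<Longrightarrow> bump y (V y) (\<psi> y)"
    by metis
  then have V: "\<And>y. y \<in> topspace Y \<Longrightarrow> openin Y (V y)"
      "\<And>y. y \<in> topspace Y \<Longrightarrow> ane TYPE('b) (subtopology Y (V y))"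
    and \<psi>: "\<And>y. y \<in> topspace Y \<Longrightarrow> continuous_map Y euclideanreal (\<psi> y)"
      "\<And>y x. y \<in> topspace Y \<Longrightarrow> x \<in> topspace Y \<Longrightarrow> \<psi> y x \<in> {0..1}" "\<And>y. y \<in> topspace Y \<Longrightarrow> \<psi> y y > 0"
      "\<And>y x. y \<in> topspace Y \<Longrightarrow> x \<in> topspace Y \<Longrightarrow> \<psi> y x > 0 \<Longrightarrow> x \<in> V y"
    unfolding bump_def by blast+
  define B where "B y = {x \<in> topspace Y. \<psi> y x \<in> {0<..}}" for y
  have "openin Y (B y)" if "y \<in> topspace Y" for y
    unfolding B_def by (rule openin_continuous_map_preimage[OF \<psi>(1)[OF that]]) simp
  then have "\<forall>U\<in>B ` topspace Y. openin Y U" "topspace Y \<subseteq> \<Union>(B ` topspace Y)"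
    using \<psi>(3) by (auto simp: B_def)
  then obtain \<V> where \<V>: "countable \<V>" "\<V> \<subseteq> B ` topspace Y" "topspace Y \<subseteq> \<Union>\<V>"
    using Y(2) unfolding Lindelof_space_alt by meson
  then obtain T where T: "countable T" "T \<subseteq> topspace Y" "topspace Y \<subseteq> \<Union>(B ` T)"
    by (metis countable_subset_image)
  \<comment> \<open>Nonemptiness of \<open>T\<close>, the reason for splitting off the empty space,
    allows an enumeration by all of \<open>nat\<close>, possibly with repetitions.\<close>
  have "T \<noteq> {}" using T(3) False by auto
  then obtain t :: "nat \<Rightarrow> 'a" where t: "range t = T"
    using T(1) by (metis range_from_nat_into)
  have tY: "t i \<in> topspace Y" for i using t T(2) by auto
  have cover: "\<exists>i. \<psi> (t i) x > 0" if "x \<in> topspace Y" for x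
    using T(3) that t by (auto simp: B_def)
  define s where "s x = suminf (\<lambda>i. \<psi> (t i) x * (1/2) ^ i)" for x
  have sum: "continuous_map Y euclideanreal s"
      "\<And>x n. x \<in> topspace Y \<Longrightarrow> \<bar>s x - (\<Sum>i<n. \<psi> (t i) x * (1/2) ^ i)\<bar> \<le> 2 * (1/2) ^ n"
      "\<And>x i. x \<in> topspace Y \<Longrightarrow> \<psi> (t i) x * (1/2) ^ i \<le> s x"
    using continuous_map_weighted_sum[of Y "\<lambda>i. \<psi> (t i)"] \<psi>(1,2)[OF tY] unfolding s_def by blast+
  have s_pos: "s x > 0" if x: "x \<in> topspace Y" for x
  proof -
    obtain i where "\<psi> (t i) x > 0" using cover[OF x] by blast
    then have "\<psi> (t i) x * (1/2) ^ i > 0" by simp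
    then show ?thesis using sum(3)[OF x, of i] by linarith
  qed
  define r where "r x = 1 / s x" for x
  have r: "continuous_map Y euclideanreal r"
    unfolding r_def using s_pos by (intro continuous_map_real_divide continuous_intros sum(1)) force+
  have r_pos: "r x > 0" if "x \<in> topspace Y" for x
    using s_pos[OF that] by (simp add: r_def)
  \<comment> \<open>Outside the first \<open>n\<close> sets only the tail of the sum is left, so
    \<open>s\<close> is small and \<open>r\<close> is large; \<open>n\<close> is chosen to push
    \<open>r\<close> above \<open>c\<close>. Using \<open>max c 1\<close> keeps the reciprocals
    positive for every \<open>c\<close>.\<close>
  have bounded: "\<exists>n. {x \<in> topspace Y. r x < c} \<subseteq> (\<Union>i<n. V (t i))" for c
  proof -
    obtain n where n: "2 * (1/2::real) ^ n < 1 / max c 1"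
    proof -
      have "\<exists>n. (1/2::real) ^ n < 1 / (2 * max c 1)"
        by (rule real_arch_pow_inv) auto
      then show ?thesis using that by (auto simp: field_simps)
    qed
    have "x \<in> (\<Union>i<n. V (t i))" if x: "x \<in> topspace Y" "r x < c" for x
    proof (rule ccontr)
      assume not: "x \<notin> (\<Union>i<n. V (t i))"
      have "\<psi> (t i) x = 0" if "i < n" for i
        using not that \<psi>(4)[OF tY x(1), of i] \<psi>(2)[OF tY x(1), of i] by force
      then have "s x \<le> 2 * (1/2) ^ n"
        using sum(2)[OF x(1), of n] by simp
      then have "s x < 1 / max c 1" using n by linarith
      moreover have "1 / max c 1 < s x"
      proof -
        have "1 / s x < max c 1" using x(2) by (simp add: r_def)
        then show ?thesis using s_pos[OF x(1)] by (simp add: field_simps)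
      qed
      ultimately show False by simp
    qed
    then show ?thesis by blast
  qed
  have shell: "ane TYPE('b) (subtopology Y {y \<in> topspace Y. \<bar>r y - a\<bar> < 1})" for a
  proof -
    let ?S = "{y \<in> topspace Y. \<bar>r y - a\<bar> < 1}"
    obtain n where n: "{x \<in> topspace Y. r x < a + 1} \<subseteq> (\<Union>i<n. V (t i))"
      using bounded by blast
    have S: "openin Y ?S"
    proof -
      have "openin Y {x \<in> topspace Y. r x \<in> {a - 1<..<a + 1}}"
        using r by (intro openin_continuous_map_preimage) auto
      moreover have "{x \<in> topspace Y. r x \<in> {a - 1<..<a + 1}} = ?S"
        by (auto simp: abs_less_iff)
      ultimately show ?thesis by simp
    qed
    have sub: "?S \<subseteq> (\<Union>i<n. V (t i))" using n by (auto simp: abs_less_iff)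
    have "ane TYPE('b) (subtopology Y (\<Union>i<n. V (t i)))"
      by (rule ane_finite_Union[OF V(1)[OF tY] V(2)[OF tY]])
    then have "ane TYPE('b) (subtopology (subtopology Y (\<Union>i<n. V (t i))) ?S)"
      by (rule ane_open_subset[OF _ openin_subtopology_subset[OF S sub]])
    then show ?thesis
      using sub by (simp add: subtopology_subtopology Int_absorb1)
  qed
  \<comment> \<open>The offset \<open>a\<close> is \<open>0\<close> for the shells around even
    numbers and \<open>1\<close> for those around odd numbers.\<close>
  have part: "openin Y (\<Union>k::nat. {y \<in> topspace Y. \<bar>r y - (2 * real k + a)\<bar> < 1}) \<and>
     ane TYPE('b) (subtopology Y (\<Union>k::nat. {y \<in> topspace Y. \<bar>r y - (2 * real k + a)\<bar> < 1}))" for a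
  proof -
    let ?E = "\<Union>k::nat. {y \<in> topspace Y. \<bar>r y - (2 * real k + a)\<bar> < 1}"
    have "openin Y ?E"
    proof (rule openin_Union, clarify)
      fix k :: nat
      have "openin Y {x \<in> topspace Y. r x \<in> {2 * real k + a - 1<..<2 * real k + a + 1}}"
        using r by (intro openin_continuous_map_preimage) auto
      moreover have "{x \<in> topspace Y. r x \<in> {2 * real k + a - 1<..<2 * real k + a + 1}} = {y \<in> topspace Y. \<bar>r y - (2 * real k + a)\<bar> < 1}"
        by (auto simp: abs_less_iff)
      ultimately show "openin Y {y \<in> topspace Y. \<bar>r y - (2 * real k + a)\<bar> < 1}" by simp
    qed
    moreover have "ane TYPE('b) (subtopology Y ?E)"
    proof (rule ane_disjoint_shells[where r = "\<lambda>y. r y - a"])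
      show "continuous_map (subtopology Y ?E) euclideanreal (\<lambda>y. r y - a)"
        using r by (intro continuous_map_from_subtopology continuous_intros) auto
      show "\<exists>k::nat. \<bar>r y - a - 2 * real k\<bar> < 1" if "y \<in> topspace (subtopology Y ?E)" for y
        using that by (auto simp: algebra_simps)
      show "ane TYPE('b) (subtopology (subtopology Y ?E) {y \<in> topspace (subtopology Y ?E). \<bar>r y - a - 2 * real k\<bar> < 1})" for k :: nat
      proof -
        have "?E \<inter> {y \<in> topspace (subtopology Y ?E). \<bar>r y - a - 2 * real k\<bar> < 1} = {y \<in> topspace Y. \<bar>r y - (2 * real k + a)\<bar> < 1}"
          by (auto simp: algebra_simps)
        then show ?thesis
          using shell[of "2 * real k + a"] by (simp add: subtopology_subtopology)
      qed
    qed
    ultimately show ?thesis ..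
  qed
  show ?thesis
  proof (rule ane_Un)
    let ?E = "\<lambda>a. \<Union>k::nat. {y \<in> topspace Y. \<bar>r y - (2 * real k + a)\<bar> < 1}"
    show "openin Y (?E 0)" "openin Y (?E 1)" "ane TYPE('b) (subtopology Y (?E 0))" "ane TYPE('b) (subtopology Y (?E 1))"
      using part by blast+
    show "topspace Y \<subseteq> ?E 0 \<union> ?E 1"
    proof
      fix y assume y: "y \<in> topspace Y"
      \<comment> \<open>Since \<open>r\<close> is positive, its integer part is a natural number,
        and \<open>y\<close> lies in the shell around it.\<close>
      define m where "m = nat \<lfloor>r y\<rfloor>"
      have m: "\<bar>r y - real m\<bar> < 1"
        using r_pos[OF y] unfolding m_def by linarith
      obtain k where "m = 2 * k \<or> m = 2 * k + 1" by (metis oddE evenE)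
      then have "\<bar>r y - (2 * real k + 0)\<bar> < 1 \<or> \<bar>r y - (2 * real k + 1)\<bar> < 1" using m by auto
      then show "y \<in> ?E 0 \<union> ?E 1" using y by blast
    qed
  qed
qed

section \<open>Manifolds as neighbourhood extensors\<close>

lemma topological_manifold_locally_compact_space:
  assumes "topological_manifold n M"
  shows "locally_compact_space M"
  unfolding locally_compact_space_def
proof
  fix x assume "x \<in> topspace M"
  then obtain U V where U: "openin M U" "x \<in> U" and V: "openin (Euclidean_space n) V"
    and hom: "subtopology M U homeomorphic_space subtopology (Euclidean_space n) V"
    using assms unfolding topological_manifold_def by blast
  have "Hausdorff_space (Euclidean_space n)"
    by (simp add: Euclidean_space_def Hausdorff_space_subtopology Hausdorff_space_product_topology)
  then have "locally_compact_space (subtopology (Euclidean_space n) V)"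
    using locally_compact_space_open_subset locally_compact_Euclidean_space V by blast
  then have "locally_compact_space (subtopology M U)"
    using hom homeomorphic_locally_compact_space by blast
  moreover have "x \<in> topspace (subtopology M U)"
    using U openin_subset by fastforce
  ultimately obtain W K where "openin (subtopology M U) W" "compactin (subtopology M U) K" "x \<in> W" "W \<subseteq> K"
    unfolding locally_compact_space_def by blast
  then show "\<exists>U K. openin M U \<and> compactin M K \<and> x \<in> U \<and> U \<subseteq> K"
    using openin_trans_full[OF _ U(1)] compactin_subtopology by metis
qed

text \<open>The definition of a manifold grants only the Hausdorff property; regularity, on which
  the theorems of Urysohn and Tietze rest here, comes from local compactness.\<close>

lemma topological_manifold_regular_space: "topological_manifold n M \<Longrightarrow> regular_space M"
  using topological_manifold_locally_compact_space locally_compact_Hausdorff_imp_regular_space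
  unfolding topological_manifold_def by blast

text \<open>Charts make the space a local extensor. The global inputs of \<open>ane_locally\<close>
  are bump functions, from local compactness and regularity, and countable subcovers, from second
  countability.\<close>

lemma topological_manifold_ane:
  assumes "topological_manifold n M"
  shows "ane TYPE('b) M"
proof (rule ane_locally)
  show "completely_regular_space M"
    using topological_manifold_locally_compact_space[OF assms] topological_manifold_regular_space[OF assms]
    by (simp add: locally_compact_regular_imp_completely_regular_space)
  show "Lindelof_space M"
    using assms by (simp add: topological_manifold_def second_countable_imp_Lindelof_space)
  fix x assume "x \<in> topspace M"
  then obtain U V where U: "openin M U" "x \<in> U" and V: "openin (Euclidean_space n) V"
    and hom: "subtopology M U homeomorphic_space subtopology (Euclidean_space n) V"
    using assms unfolding topological_manifold_def by blast
  have "ane TYPE('b) (subtopology M U)"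
    using ane_homeomorphic_space[OF ane_open_subset[OF ane_Euclidean_space V]] hom homeomorphic_space_sym by blast
  then show "\<exists>V. openin M V \<and> x \<in> V \<and> ane TYPE('b) (subtopology M V)"
    using U by blast
qed

section \<open>Extending a contraction to an open neighbourhood\<close>

lemma second_countable_prod_topology:
  assumes "second_countable X" "second_countable Y"
  shows "second_countable (prod_topology X Y)"
proof -
  obtain \<B> where \<B>: "countable \<B>" "\<forall>V\<in>\<B>. openin X V" "\<And>U x. openin X U \<Longrightarrow> x \<in> U \<Longrightarrow> \<exists>V\<in>\<B>. x \<in> V \<and> V \<subseteq> U"
    using assms(1) unfolding second_countable_def by metis
  obtain \<D> where \<D>: "countable \<D>" "\<forall>V\<in>\<D>. openin Y V" "\<And>U x. openin Y U \<Longrightarrow> x \<in> U \<Longrightarrow> \<exists>V\<in>\<D>. x \<in> V \<and> V \<subseteq> U"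
    using assms(2) unfolding second_countable_def by metis
  let ?E = "(\<lambda>(A, B). A \<times> B) ` (\<B> \<times> \<D>)"
  have "\<exists>E\<in>?E. z \<in> E \<and> E \<subseteq> W" if W: "openin (prod_topology X Y) W" "z \<in> W" for W z
  proof -
    obtain x y where z: "z = (x, y)" by (cases z)
    obtain U V where UV: "openin X U" "openin Y V" "x \<in> U" "y \<in> V" "U \<times> V \<subseteq> W"
      using W(1)[unfolded openin_prod_topology_alt, rule_format, of x y] W(2) z by auto
    obtain A B where "A \<in> \<B>" "x \<in> A" "A \<subseteq> U" "B \<in> \<D>" "y \<in> B" "B \<subseteq> V"
      using \<B>(3)[OF UV(1,3)] \<D>(3)[OF UV(2,4)] by metis
    then show ?thesis
      using UV(5) z by (intro bexI[of _ "A \<times> B"]) auto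
  qed
  moreover have "countable ?E" "\<forall>E\<in>?E. openin (prod_topology X Y) E"
    using \<B> \<D> by (auto simp: openin_prod_Times_iff)
  ultimately show ?thesis
    unfolding second_countable_def by (intro exI[of _ ?E]) auto
qed

lemma second_countable_euclideanreal: "second_countable euclideanreal"
proof -
  obtain \<B> :: "real set set" where \<B>: "countable \<B>" "topological_basis \<B>"
    using ex_countable_basis by blast
  have "\<forall>U x. open U \<and> x \<in> U \<longrightarrow> (\<exists>V\<in>\<B>. x \<in> V \<and> V \<subseteq> U)"
    using topological_basisE[OF \<B>(2)] by metis
  moreover have "\<forall>V\<in>\<B>. open V"
    using topological_basis_open[OF \<B>(2)] by metis
  ultimately show ?thesis
    unfolding second_countable_def open_openin[symmetric] using \<B>(1) by metis
qed

text \<open>Neighbourhood extension is applied twice: to \<open>P\<close>, extending the end of the contraction to a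
  neighbourhood \<open>U\<close> of \<open>A\<close>, and to \<open>M\<close>, extending the contraction from
  \<open>{0, 1} \<times> U \<union> [0, 1] \<times> A\<close> to a neighbourhood in \<open>[0, 1] \<times> U\<close>.\<close>

lemma contractible_within_to_open_neighbourhood:
  fixes M :: "'a topology"
  assumes M: "regular_space M" "second_countable M" "ane TYPE(real \<times> 'a) M"
    and P: "ane TYPE('a) (subtopology M P)"
    and A: "closedin M A" "contractible_within_to M A P"
  obtains U a b where "openin M U" "A \<subseteq> U"
    "continuous_map (subtopology M U) (subtopology M P) a" "continuous_map (subtopology M P) M b"
    "homotopic_with (\<lambda>_. True) (subtopology M U) M id (b \<circ> a)"
proof -
  have AM: "A \<subseteq> topspace M" using A(1) by (rule closedin_subset)
  let ?I = "top_of_set {0..1::real}"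
  obtain f where f: "homotopic_with (\<lambda>_. True) (subtopology M A) M id f"
      "subtopology M (f ` A) homeomorphic_space subtopology M P"
    using A(2) unfolding contractible_within_to_def by blast
  obtain H where H: "continuous_map (prod_topology ?I (subtopology M A)) M H" "\<And>x. H (0, x) = x" "\<And>x. H (1, x) = f x"
    using f(1) unfolding homotopic_with_def by auto
  obtain u v where uv: "continuous_map (subtopology M (f ` A)) (subtopology M P) u"
      "continuous_map (subtopology M P) (subtopology M (f ` A)) v"
      "\<And>z. z \<in> topspace (subtopology M (f ` A)) \<Longrightarrow> v (u z) = z"
    using f(2) unfolding homeomorphic_space_def homeomorphic_maps_def by blast
  have fM: "continuous_map (subtopology M A) M f"
    using f(1) homotopic_with_imp_continuous_maps by blast
  then have fA: "continuous_map (subtopology M A) (subtopology M (f ` A)) f"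
    using AM by (auto simp: continuous_map_in_subtopology)
  \<comment> \<open>As \<open>a\<close> will extend \<open>u \<circ> f\<close>, this says that
    \<open>v \<circ> a\<close> agrees on \<open>A\<close> with the end \<open>f\<close> of the
    contraction, so the pieces of \<open>F\<close> match at time \<open>1\<close>.\<close>
  have vuf: "v (u (f x)) = f x" if "x \<in> A" for x
    using uv(3)[of "f x"] fM that AM by (auto simp: continuous_map_def)
  obtain U1 a where U1: "openin M U1" "A \<subseteq> U1" and a: "continuous_map (subtopology M U1) (subtopology M P) a"
      "\<And>x. x \<in> A \<Longrightarrow> a x = (u \<circ> f) x"
    using aneD[OF P M(1,2) A(1) continuous_map_compose[OF fA uv(1)]] by metis
  have U1M: "U1 \<subseteq> topspace M" using U1(1) by (rule openin_subset)
  have v: "continuous_map (subtopology M P) M v"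
    using uv(2) continuous_map_into_fulltopology by blast
  let ?X = "prod_topology ?I (subtopology M U1)"
  have X: "regular_space ?X" "second_countable ?X"
    using M(1,2) by (simp_all add: regular_space_prod_topology regular_space_subtopology regular_space_euclidean
        second_countable_prod_topology second_countable_subtopology second_countable_euclideanreal)
  have sndX: "continuous_map (subtopology ?X S) (subtopology M U1) snd" for S
    by (intro continuous_map_from_subtopology continuous_map_snd)
  \<comment> \<open>The partial homotopy to be extended: the inclusion at time \<open>0\<close>, the
    map \<open>v \<circ> a\<close> through the submanifold at time \<open>1\<close>, and the given
    contraction over \<open>A\<close>.\<close>
  define F where "F = (\<lambda>p. if p \<in> {0::real} \<times> U1 then snd p else if p \<in> {1} \<times> U1 then v (a (snd p)) else H p)"
  let ?C = "({0} \<times> U1) \<union> (({1} \<times> U1) \<union> ({0..1} \<times> A))"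
  have times: "closedin ?X (S \<times> U1)" if "closed S" "S \<subseteq> {0..1}" for S
    using that U1M by (auto simp: closedin_prod_Times_iff closedin_subset_topspace topspace_subtopology_subset
        intro!: closedin_subset_topspace)
  have cl0: "closedin ?X ({0} \<times> U1)" and cl1: "closedin ?X ({1} \<times> U1)"
    by (rule times; simp)+
  have clA: "closedin ?X ({0..1} \<times> A)"
    using A(1) U1(2) by (auto simp: closedin_prod_Times_iff intro!: closedin_subset_topspace)
  have contH: "continuous_map (subtopology ?X ({0..1} \<times> A)) M H"
  proof -
    have "subtopology ?X ({0..1} \<times> A) = prod_topology ?I (subtopology M A)"
      using U1(2) by (simp add: subtopology_Times[symmetric] prod_topology_subtopology subtopology_subtopology Int_assoc Int_absorb1 Times_Int_Times)
    then show ?thesis using H(1) by simp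
  qed
  have "continuous_map (subtopology ?X (({1} \<times> U1) \<union> ({0..1} \<times> A))) M (\<lambda>p. if p \<in> {1} \<times> U1 then v (a (snd p)) else H p)"
  proof (rule continuous_map_closed_Un[OF cl1 clA _ contH])
    show "continuous_map (subtopology ?X ({1} \<times> U1)) M (\<lambda>p. v (a (snd p)))"
      using continuous_map_compose[OF continuous_map_compose[OF sndX a(1)] v] by (simp add: o_def)
    show "v (a (snd p)) = H p" if "p \<in> {1} \<times> U1" "p \<in> {0..1} \<times> A" for p
      using that a(2) vuf H(3) by auto
  qed
  then have "continuous_map (subtopology ?X ?C) M F"
    unfolding F_def
  proof (rule continuous_map_closed_Un[OF cl0 closedin_Un[OF cl1 clA], rotated])
    show "continuous_map (subtopology ?X ({0} \<times> U1)) M snd"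
      using sndX continuous_map_into_fulltopology by blast
    show "snd p = (if p \<in> {1} \<times> U1 then v (a (snd p)) else H p)"
      if "p \<in> {0} \<times> U1" "p \<in> {1} \<times> U1 \<union> {0..1} \<times> A" for p
      using that H(2) by auto
  qed
  then obtain W G where W: "openin ?X W" "?C \<subseteq> W" and G: "continuous_map (subtopology ?X W) M G" "\<And>p. p \<in> ?C \<Longrightarrow> G p = F p"
    using aneD[OF M(3) X closedin_Un[OF cl0 closedin_Un[OF cl1 clA]]] by metis
  \<comment> \<open>The tube lemma: \<open>U\<close> consists of the points whose whole segment lies
    in \<open>W\<close>, and it is open because projection along the compact interval is a closed
    map.\<close>
  define U where "U = U1 - snd ` (topspace ?X - W)"
  have "closed_map ?X (subtopology M U1) snd"
    by (rule closed_map_snd) (simp add: compact_space_subtopology)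
  moreover have "closedin ?X (topspace ?X - W)"
    using W(1) by blast
  ultimately have "closedin (subtopology M U1) (snd ` (topspace ?X - W))"
    unfolding closed_map_def by blast
  then have "openin (subtopology M U1) (topspace (subtopology M U1) - snd ` (topspace ?X - W))"
    by blast
  moreover have top: "topspace (subtopology M U1) = U1" using U1M by auto
  ultimately have "openin (subtopology M U1) U"
    by (simp add: U_def)
  then have "openin M U" using U1(1) by (rule openin_trans_full)
  moreover have IU: "{0..1} \<times> U \<subseteq> W"
    unfolding U_def using top by (force simp: image_iff)
  moreover have "A \<subseteq> U"
    unfolding U_def using U1(2) W(2) top by auto
  moreover have "continuous_map (subtopology M U) (subtopology M P) a"
    using continuous_map_from_subtopology_mono[OF a(1), of U] by (auto simp: U_def)
  moreover have "homotopic_with (\<lambda>_. True) (subtopology M U) M id (v \<circ> a)"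
  proof -
    have UU1: "U \<subseteq> U1" by (auto simp: U_def)
    have "subtopology ?X ({0..1} \<times> U) = prod_topology ?I (subtopology M U)"
      using UU1 by (simp add: subtopology_Times[symmetric] prod_topology_subtopology subtopology_subtopology Int_assoc Int_absorb1 Times_Int_Times)
    then have "continuous_map (prod_topology ?I (subtopology M U)) M G"
      using continuous_map_from_subtopology_mono[OF G(1) IU] by simp
    moreover have "G (0, x) = x" "G (1, x) = v (a x)" if "x \<in> U" for x
      using that UU1 G(2)[of "(0, x)"] G(2)[of "(1, x)"] by (auto simp: F_def)
    ultimately show ?thesis
      by (subst homotopic_with) auto
  qed
  ultimately show ?thesis
    using that[of U a v] v by blast
qed

section \<open>Category and length\<close>

text \<open>Front and back faces of a simplex in \<open>U\<close> remain in \<open>U\<close>, so a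
  single factor vanishing there annihilates every summand of the product.\<close>

lemma cup_list_vanishes:
  assumes "w \<in> set ws" "\<And>p \<sigma>. singular_simplex p (subtopology X U) \<sigma> \<Longrightarrow> w p \<sigma> = 0"
  shows "singular_simplex n (subtopology X U) \<sigma> \<Longrightarrow> cup_list X ws n \<sigma> = 0"
  using assms(1)
proof (induction ws arbitrary: n \<sigma>)
  case (Cons v ws)
  have "v p (front_face p \<sigma>) * cup_list X ws (n - p) (back_face p (n - p) \<sigma>) = 0" if "p \<le> n" for p
  proof -
    have "singular_simplex p (subtopology X U) (front_face p \<sigma>)"
      "singular_simplex (n - p) (subtopology X U) (back_face p (n - p) \<sigma>)"
      using singular_simplex_front_face[OF Cons.prems(1) that]
        singular_simplex_back_face[of p "n - p"] Cons.prems(1) that by auto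
    then show ?thesis
      using Cons.IH Cons.prems(2) assms(2) by (cases "v = w") auto
  qed
  then have "cup X v (cup_list X ws) n \<sigma> = 0"
    by (simp add: cup_def)
  then show ?case
    by (simp add: cup_list_def)
qed simp

lemma cup_list_coboundary_of_open_cover:
  fixes z :: "nat \<Rightarrow> ('a, 'c::comm_ring_1) cochain"
  assumes U: "\<And>i. i < k \<Longrightarrow> openin X (U i)" "topspace X \<subseteq> (\<Union>i<k. U i)"
    and z: "\<And>i. i < k \<Longrightarrow> z i \<in> cocycles X"
    and local: "\<And>i. i < k \<Longrightarrow> pullback (subtopology X (U i)) id (z i) \<in> coboundaries (subtopology X (U i))"
  shows "cup_list X (map z [0..<k]) \<in> coboundaries X"
proof -
  have "\<exists>b\<in>coboundaries X. \<forall>p \<sigma>. singular_simplex p (subtopology X (U i)) \<sigma> \<longrightarrow> b p \<sigma> + z i p \<sigma> = 0"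
    if i: "i < k" for i
  proof -
    let ?XU = "subtopology X (U i)"
    obtain v where v: "v \<in> cochains ?XU" "pullback ?XU id (z i) = coboundary ?XU v"
      using local[OF i] by (auto simp: coboundaries_def)
    \<comment> \<open>Extension by zero: a cochain of the subspace vanishes off the simplices inside
      it, so \<open>v\<close> already is a cochain of \<open>X\<close>. Its coboundary in
      \<open>X\<close> may have further values, but inside \<open>U i\<close> it is unchanged and
      cancels \<open>z i\<close>.\<close>
    have "v \<in> cochains X"
      using v(1) by (auto simp: cochains_def singular_simplex_subtopology)
    then have "(\<lambda>p \<sigma>. - coboundary X v p \<sigma>) \<in> coboundaries X"
      by (intro coboundaries_uminus) (simp add: coboundaries_def)
    moreover have "- coboundary X v p \<sigma> + z i p \<sigma> = 0" if \<sigma>: "singular_simplex p ?XU \<sigma>" for p \<sigma>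
    proof -
      have "simplex_map p id \<sigma> = \<sigma>"
        using simplex_map_id_gen[OF \<sigma>, of id] by simp
      then have "z i p \<sigma> = coboundary ?XU v p \<sigma>"
        using fun_cong[OF fun_cong[OF v(2), of p], of \<sigma>] \<sigma> by (simp add: pullback_def)
      also have "\<dots> = coboundary X v p \<sigma>"
        using \<sigma> by (simp add: coboundary_def singular_simplex_subtopology)
      finally show ?thesis by simp
    qed
    ultimately show ?thesis
      by (intro bexI[of _ "\<lambda>p \<sigma>. - coboundary X v p \<sigma>"]) auto
  qed
  then obtain b where b: "\<And>i. i < k \<Longrightarrow> b i \<in> coboundaries X"
    "\<And>i p \<sigma>. i < k \<Longrightarrow> singular_simplex p (subtopology X (U i)) \<sigma> \<Longrightarrow> b i p \<sigma> + z i p \<sigma> = 0"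
    by metis
  \<comment> \<open>The representative vanishing on \<open>U i\<close>. Each simplex that is small
    for the cover lies in some \<open>U i\<close>, where the factor \<open>w i\<close> alone kills
    the product of all of them.\<close>
  define w where "w i = (\<lambda>p \<sigma>. b i p \<sigma> + z i p \<sigma>)" for i
  have w: "w i \<in> cocycles X" if "i < k" for i
    unfolding w_def using b(1)[OF that] z[OF that] coboundaries_subset_cocycles[of X]
    by (intro cocycles_add[of "b i" X "z i"]) auto
  have "cup_list X (map w [0..<k]) \<in> coboundaries X"
  proof (rule cocycle_vanishing_on_small_simplices[of "U ` {..<k}" X])
    show "cup_list X (map w [0..<k]) \<in> cocycles X"
      using w by (intro cocycles_cup_list) auto
    fix p V \<sigma>
    assume "V \<in> U ` {..<k}" "singular_simplex p (subtopology X V) \<sigma>"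
    then obtain i where i: "i < k" "singular_simplex p (subtopology X (U i)) \<sigma>"
      by auto
    have "w i \<in> set (map w [0..<k])"
      using i(1) by auto
    then show "cup_list X (map w [0..<k]) p \<sigma> = 0"
      by (rule cup_list_vanishes[OF _ _ i(2)]) (simp add: w_def b(2)[OF i(1)])
  qed (use U in auto)
  moreover have "list_all2 (\<lambda>z w. z \<in> cocycles X \<and> (\<exists>b\<in>coboundaries X. w = (\<lambda>p \<sigma>. b p \<sigma> + z p \<sigma>)))
      (map z [0..<k]) (map w [0..<k])"
    unfolding list_all2_conv_all_nth using z b(1) by (auto simp: w_def intro!: bexI[of _ "b _"])
  ultimately show ?thesis
    using cup_list_cohomologous by blast
qed

lemma cup_list_concat:
  "(\<And>zs. zs \<in> set zss \<Longrightarrow> set zs \<subseteq> cocycles X) \<Longrightarrow>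
     cup_list X (concat zss) = cup_list X (map (cup_list X) zss)"
proof (induction zss)
  case (Cons zs zss)
  have "set (concat zss) \<subseteq> cocycles X"
    using Cons.prems by auto
  then have "cup_list X (concat (zs # zss)) = cup X (cup_list X zs) (cup_list X (concat zss))"
    using Cons.prems cup_list_append[of zs X "concat zss"] by simp
  then show ?case
    using Cons by (simp add: cup_list_def)
qed simp

lemma concat_blocks: "concat (map (\<lambda>i. take N (drop (i * N) zs)) [0..<k]) = take (k * N) zs"
proof (induction k)
  case (Suc k)
  moreover have "take (Suc k * N) zs = take (k * N) zs @ take N (drop (k * N) zs)"
    using take_add[of "k * N" N zs] by (simp add: add.commute)
  ultimately show ?case
    by simp
qed simp

lemma cup_list_longer_than_long:
  fixes zs :: "('a, 'c::comm_ring_1) cochain list"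
  assumes "set zs \<subseteq> positive_cocycles X" "long TYPE('c) X < enat (length zs)"
  shows "cup_list X zs \<in> coboundaries X"
proof (rule ccontr)
  assume "cup_list X zs \<notin> coboundaries X"
  then have "enat (length zs) \<le> long TYPE('c) X"
    unfolding long_eq_Sup_cocycles using assms(1) by (intro Sup_upper) blast
  then show False
    using assms(2) by simp
qed

text \<open>Up to homotopy \<open>h\<close> factors through \<open>Z\<close>, and pullback to
  \<open>Z\<close> preserves products and positive degrees; there the list is too long for a nonzero
  product. It is applied to the inclusion of a neighbourhood, with the submanifold as
  \<open>Z\<close>.\<close>

lemma pullback_cup_list_coboundary:
  fixes zs :: "('a, 'c::comm_ring_1) cochain list"
  assumes "continuous_map Y Z a" "continuous_map Z X b" "homotopic_with (\<lambda>_. True) Y X h (b \<circ> a)"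
    and zs: "set zs \<subseteq> positive_cocycles X" "long TYPE('c) Z < enat (length zs)"
  shows "pullback Y h (cup_list X zs) \<in> coboundaries Y"
proof -
  have "cup_list Z (map (pullback Z b) zs) \<in> coboundaries Z"
    using zs positive_cocycles_pullback[OF assms(2)] by (intro cup_list_longer_than_long) auto
  then have "pullback Y a (pullback Z b (cup_list X zs)) \<in> coboundaries Y"
    using coboundaries_pullback[OF assms(1)] pullback_cup_list[OF assms(2), of zs] by simp
  then have "pullback Y (b \<circ> a) (cup_list X zs) \<in> coboundaries Y"
    by (simp add: pullback_compose[OF assms(1)])
  moreover have "cup_list X zs \<in> cocycles X"
    using zs(1) by (intro cocycles_cup_list) (auto simp: positive_cocycles_def)
  then obtain c where "c \<in> coboundaries Y"
      "pullback Y h (cup_list X zs) = (\<lambda>p \<sigma>. c p \<sigma> + pullback Y (b \<circ> a) (cup_list X zs) p \<sigma>)"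
    using homotopic_pullback_cohomologous[OF homotopic_with_symD[OF assms(3)]] by metis
  ultimately show ?thesis
    by (simp add: coboundaries_add)
qed

lemma length_less_category_times_long:
  fixes M :: "'a topology" and zs :: "('a, 'c::comm_ring_1) cochain list"
  assumes M: "topological_manifold n M" and P: "closed_submanifold P M"
    and A: "\<And>i. i < k \<Longrightarrow> closedin M (A i)" "\<And>i. i < k \<Longrightarrow> contractible_within_to M (A i) P"
      "topspace M = (\<Union>i<k. A i)"
    and l: "long TYPE('c) (subtopology M P) = enat l"
    and zs: "set zs \<subseteq> positive_cocycles M" "cup_list M zs \<notin> coboundaries M"
  shows "length zs < k * Suc l"
proof (rule ccontr)
  assume "\<not> length zs < k * Suc l"
  then have len: "k * Suc l \<le> length zs" by simp
  have reg: "regular_space M" "second_countable M"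
    using M topological_manifold_regular_space by (auto simp: topological_manifold_def)
  obtain m where m: "topological_manifold m (subtopology M P)"
    using P unfolding closed_submanifold_def by blast
  have "\<exists>U a b. openin M U \<and> A i \<subseteq> U \<and> continuous_map (subtopology M U) (subtopology M P) a \<and>
      continuous_map (subtopology M P) M b \<and> homotopic_with (\<lambda>_. True) (subtopology M U) M id (b \<circ> a)"
    if "i < k" for i
    using contractible_within_to_open_neighbourhood[OF reg topological_manifold_ane[OF M]
        topological_manifold_ane[OF m] A(1,2)[OF that]] by metis
  then obtain U a b where U: "\<And>i. i < k \<Longrightarrow> openin M (U i)" "\<And>i. i < k \<Longrightarrow> A i \<subseteq> U i"
    and a: "\<And>i. i < k \<Longrightarrow> continuous_map (subtopology M (U i)) (subtopology M P) (a i)"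
    and b: "\<And>i. i < k \<Longrightarrow> continuous_map (subtopology M P) M (b i)"
    and hom: "\<And>i. i < k \<Longrightarrow> homotopic_with (\<lambda>_. True) (subtopology M (U i)) M id (b i \<circ> a i)"
    by metis
  define block where "block i = take (Suc l) (drop (i * Suc l) zs)" for i
  have block: "set (block i) \<subseteq> positive_cocycles M" for i
    using zs(1) unfolding block_def by (meson order_trans set_drop_subset set_take_subset)
  have block_length: "length (block i) = Suc l" if "i < k" for i
  proof -
    have "Suc i * Suc l \<le> length zs"
      using that len by (meson Suc_leI le_trans mult_le_mono1)
    then show ?thesis by (simp add: block_def)
  qed
  have cocycles: "set (block i) \<subseteq> cocycles M" for i
    using block[of i] by (auto simp: positive_cocycles_def)
  have "cup_list M (map (\<lambda>i. cup_list M (block i)) [0..<k]) \<in> coboundaries M"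
  proof (rule cup_list_coboundary_of_open_cover[of k M U])
    show "topspace M \<subseteq> (\<Union>i<k. U i)"
      using A(3) U(2) by fastforce
    show "cup_list M (block i) \<in> cocycles M" for i
      by (rule cocycles_cup_list[OF cocycles])
    show "pullback (subtopology M (U i)) id (cup_list M (block i)) \<in> coboundaries (subtopology M (U i))"
      if "i < k" for i
      using that block_length l
      by (intro pullback_cup_list_coboundary[OF a b hom block]) auto
  qed (use U(1) in auto)
  moreover have "cup_list M (map (\<lambda>i. cup_list M (block i)) [0..<k]) = cup_list M (take (k * Suc l) zs)"
  proof -
    have "concat (map block [0..<k]) = take (k * Suc l) zs"
      unfolding block_def[abs_def] by (rule concat_blocks)
    moreover have "cup_list M (concat (map block [0..<k])) = cup_list M (map (cup_list M) (map block [0..<k]))"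
      by (rule cup_list_concat) (use cocycles in auto)
    ultimately show ?thesis by (simp add: o_def)
  qed
  ultimately have "cup_list M (take (k * Suc l) zs) \<in> coboundaries M"
    by simp
  \<comment> \<open>The list may be longer than \<open>k * Suc l\<close>; the surplus factors are
    absorbed because coboundaries form an ideal.\<close>
  moreover have "set zs \<subseteq> cocycles M"
    using zs(1) by (auto simp: positive_cocycles_def)
  then have "set (take (k * Suc l) zs) \<subseteq> cocycles M" "set (drop (k * Suc l) zs) \<subseteq> cocycles M"
    by (meson order_trans set_take_subset set_drop_subset)+
  ultimately have "cup_list M (take (k * Suc l) zs @ drop (k * Suc l) zs) \<in> coboundaries M"
    by (simp only: cup_list_append coboundaries_cup_right cocycles_cup_list)
  then show False
    using zs(2) by simp
qed

text \<open>Pullback compares cochains of \<open>M\<close> and of the submanifold over one ring,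
  hence the same \<open>'c\<close> in both lengths. The theorem instantiates it by
  \<open>int\<close>, \<open>real\<close> and \<open>bit\<close>.\<close>

lemma P_cat_ge_long_quotient:
  fixes M :: "'a topology"
  assumes M: "topological_manifold n M" "topspace M \<noteq> {}" and P: "closed_submanifold P M"
  shows "ereal_of_enat (P_cat P M) \<ge> (ereal_of_enat (long TYPE('c::comm_ring_1) M) + 1)
           / (ereal_of_enat (long TYPE('c) (subtopology M P)) + 1)"
proof (cases "P_cat P M = \<infinity> \<or> long TYPE('c) (subtopology M P) = \<infinity>")
  \<comment> \<open>If the length of the submanifold is infinite, the quotient is a product with the
    inverse of infinity, which is \<open>0\<close>; in \<open>ereal\<close> it stays
    \<open>0\<close> even for an infinite numerator.\<close>
  case True
  then show ?thesis by auto
next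
  case False
  then obtain k l where k: "P_cat P M = enat k" and l: "long TYPE('c) (subtopology M P) = enat l"
    by auto
  let ?S = "{enat k | k. \<exists>A :: nat \<Rightarrow> 'a set.
     (\<forall>i<k. closedin M (A i) \<and> contractible_within_to M (A i) P) \<and> topspace M = (\<Union>i<k. A i)}"
  \<comment> \<open>A finite infimum in \<open>enat\<close> is a least element, hence attained by an
    actual cover.\<close>
  have "enat k \<in> ?S"
    using k unfolding P_cat_def Inf_enat_def by (metis (no_types, lifting) LeastI_ex all_not_in_conv enat.distinct(1))
  then obtain A :: "nat \<Rightarrow> 'a set" where A: "\<And>i. i < k \<Longrightarrow> closedin M (A i)"
      "\<And>i. i < k \<Longrightarrow> contractible_within_to M (A i) P" "topspace M = (\<Union>i<k. A i)"
    by auto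
  \<comment> \<open>A nonempty space needs at least one set. Thus the truncated difference
    \<open>k * Suc l - 1\<close> below is a true one, and adding \<open>1\<close> gives back
    \<open>k * (l + 1)\<close>.\<close>
  have "k > 0"
    using A(3) M(2) by (cases k) auto
  have "long TYPE('c) M \<le> enat (k * Suc l - 1)"
    unfolding long_eq_Sup_cocycles
  proof (rule Sup_least)
    fix q assume "q \<in> {enat (length zs) | zs :: ('a, 'c) cochain list.
      set zs \<subseteq> positive_cocycles M \<and> cup_list M zs \<notin> coboundaries M}"
    then obtain zs :: "('a, 'c) cochain list" where q: "q = enat (length zs)"
        and zs: "set zs \<subseteq> positive_cocycles M" "cup_list M zs \<notin> coboundaries M"
      by auto
    have "length zs < k * Suc l"
      using length_less_category_times_long[OF M(1) P A l zs] .
    then show "q \<le> enat (k * Suc l - 1)"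
      by (simp add: q)
  qed
  then obtain m where m: "long TYPE('c) M = enat m" "m \<le> k * Suc l - 1"
    by (metis enat_ile enat_ord_simps(1))
  then have "m + 1 \<le> k * (l + 1)"
    using \<open>k > 0\<close> by (cases k) auto
  then have "real (m + 1) \<le> real (k * (l + 1))"
    by (rule of_nat_mono)
  then have "(real m + 1) / (real l + 1) \<le> real k"
    by (simp add: field_simps)
  then show ?thesis
    by (simp add: k l m(1))
qed

theorem mainTheorem20:
  fixes M :: "'a topology" and P :: "'a set" and n :: nat
  assumes "topological_manifold n M"
    and "topspace M \<noteq> {}"
    and "closed_submanifold P M"
  shows "(orientable n M \<longrightarrow>
            ereal_of_enat (P_cat P M)
              \<ge> (ereal_of_enat (long TYPE(int) M) + 1)
                  / (ereal_of_enat (long TYPE(int) (subtopology M P)) + 1) \<and>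
            ereal_of_enat (P_cat P M)
              \<ge> (ereal_of_enat (long TYPE(real) M) + 1)
                  / (ereal_of_enat (long TYPE(real) (subtopology M P)) + 1)) \<and>
         (\<not> orientable n M \<longrightarrow>
            ereal_of_enat (P_cat P M)
              \<ge> (ereal_of_enat (long TYPE(bit) M) + 1)
                  / (ereal_of_enat (long TYPE(bit) (subtopology M P)) + 1))"
  by (intro conjI impI P_cat_ge_long_quotient[OF assms])

end
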